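(* Let $\mathfrak{g}$ be a complex quadratic vector space (possibly infinite dimensional) with non degenerate symmetric bilinear form $B$. (1) An element $C\in\mathcal{M}_a^k(\mathfrak{g})$ is a cyclic cochain if and only if $\hat C\in\bigwedge_+\mathfrak{g}$. The map $\Theta\colon\mathcal{C}_c(\mathfrak{g})\to\bigwedge_+\mathfrak{g}$ defined by $\Theta(C)=\hat C$ is one to one. (2) When $\mathfrak{g}$ is finite dimensional, the map $\Theta\colon\mathcal{C}_c(\mathfrak{g})\to\bigwedge_+\mathfrak{g}$ is an isomorphism. (3) $\mathcal{C}_c(\mathfrak{g})$ is a subalgebra of the graded Lie algebra $\mathcal{M}_a(\mathfrak{g})$, i.e. it is stable under the bracket $[\cdot,\cdot]_a$.
   Context: $\mathcal{M}_a^0(\mathfrak{g})=\mathfrak{g}$ and, for $k\ge1$, $\mathcal{M}_a^k(\mathfrak{g})$ is the space of skew symmetric $k$-linear maps $\mathfrak{g}^k\to\mathfrak{g}$; $\mathcal{M}_a(\mathfrak{g})=\sum_k\mathcal{M}_a^k(\mathfrak{g})$. $\bigwedge^k\mathfrak{g}$ is the space of skew symmetric $k$-linear forms on $\mathfrak{g}$ and $\bigwedge_+\mathfrak{g}=\sum_{k\ge1}\bigwedge^k\mathfrak{g}$. Graded Lie bracket: with $\mathfrak{S}_{p,q}$ the set of permutations $\sigma\in\mathfrak{S}_{p+q}$ with $\sigma(1)<\dots<\sigma(p)$ and $\sigma(p+1)<\dots<\sigma(p+q)$, and $\varepsilon$ the signature, for $F\in\mathcal{M}_a^{p+1}(\mathfrak{g})$,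 $G\in\mathcal{M}_a^{q+1}(\mathfrak{g})$ ($p,q\ge-1$), $[F,G]_a\in\mathcal{M}_a^{p+q+1}(\mathfrak{g})$ is $$[F,G]_a(X_1,\dots,X_{p+q+1})=(-1)^{pq}\sum_{\sigma\in\mathfrak{S}_{q+1,p}}\varepsilon(\sigma)F(G(X_{\sigma(1)},\dots,X_{\sigma(q+1)}),X_{\sigma(q+2)},\dots,X_{\sigma(p+q+1)})-\sum_{\sigma\in\mathfrak{S}_{p+1,q}}\varepsilon(\sigma)G(F(X_{\sigma(1)},\dots,X_{\sigma(p+1)}),X_{\sigma(p+2)},\dots,X_{\sigma(p+q+1)})$$ (so $[X,G]_a=-G(X,\cdot,\dots,\cdot)$ for $X\in\mathfrak{g}$, and $[X,Y]_a=0$ for $X,Y\in\mathcal{M}_a^0(\mathfrak{g})$). For $C\in\mathcal{M}_a^k(\mathfrak{g})$, the $(k+1)$-linear form $\hat C$ is: $\hat C(Y)=B(C,Y)$ if $k=0$; $\hat C(Y_1,\dots,Y_{k+1})=B(C(Y_1,\dots,Y_k),Y_{k+1})$ if $k>0$. $C$ is a cyclic cochain if $\hat C(Y_1,\dots,Y_{k+1})=(-1)^k\hat C(Y_{k+1},Y_1,\dots,Y_k)$ for all $Y_i\in\mathfrak{g}$. $\mathcal{C}_c(\mathfrak{g})$ is the space of cyclic cochains (sums of homogeneous ones). *)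

theory Defs
  imports Complex_Main "HOL-Combinatorics.Permutations" "HOL-Library.Function_Algebras"
begin

locale quadratic_vector_space = vector_space scale
  for scale :: "complex \<Rightarrow> 'a::ab_group_add \<Rightarrow> 'a" +
  fixes B :: "'a \<Rightarrow> 'a \<Rightarrow> complex"
  assumes linear_left: "\<And>y. Vector_Spaces.linear scale (*) (\<lambda>x. B x y)"
    and linear_right: "\<And>x. Vector_Spaces.linear scale (*) (\<lambda>y. B x y)"
    and symmetric: "\<And>x y. B x y = B y x"
    and nondegenerate: "\<And>x. (\<And>y. B x y = 0) \<Longrightarrow> x = 0"

text \<open>
  A map of \<open>k\<close> arguments is represented by a function on lists which is \<open>0\<close> on the lists of length
  different from \<open>k\<close>; for \<open>k = 0\<close> such a function amounts to its value at \<open>[]\<close>, that is, to an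
  element of the target space. A finite sum of maps of different arities is then the pointwise sum
  of functions on lists, and its component of arity \<open>k\<close> is its restriction to lists of length \<open>k\<close>,
  so that sums over the arity are automatically direct.
\<close>

definition multilinear ::
  "(complex \<Rightarrow> 'a::ab_group_add \<Rightarrow> 'a) \<Rightarrow> (complex \<Rightarrow> 'b::ab_group_add \<Rightarrow> 'b) \<Rightarrow> nat \<Rightarrow> ('a list \<Rightarrow> 'b) \<Rightarrow> bool"
  where "multilinear s1 s2 k f \<longleftrightarrow>
    (\<forall>xs i. length xs = k \<longrightarrow> i < k \<longrightarrow> Vector_Spaces.linear s1 s2 (\<lambda>x. f (xs[i := x])))"

definition skew_symmetric ::
  "(complex \<Rightarrow> 'b \<Rightarrow> 'b) \<Rightarrow> nat \<Rightarrow> ('a list \<Rightarrow> 'b) \<Rightarrow> bool"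
  where "skew_symmetric s2 k f \<longleftrightarrow>
    (\<forall>\<sigma> xs. \<sigma> permutes {..<k} \<longrightarrow> length xs = k \<longrightarrow>
      f (permute_list \<sigma> xs) = s2 (of_int (sign \<sigma>)) (f xs))"

definition skew_maps ::
  "(complex \<Rightarrow> 'a::ab_group_add \<Rightarrow> 'a) \<Rightarrow> (complex \<Rightarrow> 'b::ab_group_add \<Rightarrow> 'b) \<Rightarrow> nat \<Rightarrow> ('a list \<Rightarrow> 'b) set"
  where "skew_maps s1 s2 k =
    {f. multilinear s1 s2 k f \<and> skew_symmetric s2 k f \<and> (\<forall>xs. length xs \<noteq> k \<longrightarrow> f xs = 0)}"

definition graded_sum ::
  "nat set \<Rightarrow> (nat \<Rightarrow> ('a list \<Rightarrow> 'b::comm_monoid_add) set) \<Rightarrow> ('a list \<Rightarrow> 'b) set"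
  where "graded_sum I V =
    {f. \<exists>K F. finite K \<and> K \<subseteq> I \<and> (\<forall>k\<in>K. F k \<in> V k) \<and> f = (\<Sum>k\<in>K. F k)}"

definition cochains_deg ::
  "(complex \<Rightarrow> 'a::ab_group_add \<Rightarrow> 'a) \<Rightarrow> nat \<Rightarrow> ('a list \<Rightarrow> 'a) set"
  where "cochains_deg scale k = skew_maps scale scale k"

definition cochains :: "(complex \<Rightarrow> 'a::ab_group_add \<Rightarrow> 'a) \<Rightarrow> ('a list \<Rightarrow> 'a) set"
  where "cochains scale = graded_sum UNIV (cochains_deg scale)"

definition forms_deg ::
  "(complex \<Rightarrow> 'a::ab_group_add \<Rightarrow> 'a) \<Rightarrow> nat \<Rightarrow> ('a list \<Rightarrow> complex) set"
  where "forms_deg scale k = skew_maps scale (*) k"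

definition forms_plus :: "(complex \<Rightarrow> 'a::ab_group_add \<Rightarrow> 'a) \<Rightarrow> ('a list \<Rightarrow> complex) set"
  where "forms_plus scale = graded_sum {1..} (forms_deg scale)"

text \<open>
  The assignment of \<open>hat B C\<close> to \<open>C\<close> is given by the same formula in every degree, so this is also its linear
  extension to sums of homogeneous cochains.
\<close>

definition hat :: "('a \<Rightarrow> 'a \<Rightarrow> complex) \<Rightarrow> ('a list \<Rightarrow> 'a) \<Rightarrow> ('a list \<Rightarrow> complex)"
  where "hat B C ys = (if ys = [] then 0 else B (C (butlast ys)) (last ys))"

definition cyclic_cochains_deg ::
  "(complex \<Rightarrow> 'a::ab_group_add \<Rightarrow> 'a) \<Rightarrow> ('a \<Rightarrow> 'a \<Rightarrow> complex) \<Rightarrow> nat \<Rightarrow> ('a list \<Rightarrow> 'a) set"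
  where "cyclic_cochains_deg scale B k =
    {C \<in> cochains_deg scale k.
      \<forall>ys. length ys = k + 1 \<longrightarrow> hat B C ys = (-1) ^ k * hat B C (last ys # butlast ys)}"

definition cyclic_cochains ::
  "(complex \<Rightarrow> 'a::ab_group_add \<Rightarrow> 'a) \<Rightarrow> ('a \<Rightarrow> 'a \<Rightarrow> complex) \<Rightarrow> ('a list \<Rightarrow> 'a) set"
  where "cyclic_cochains scale B = graded_sum UNIV (cyclic_cochains_deg scale B)"

definition shuffle_perms :: "nat \<Rightarrow> nat \<Rightarrow> (nat \<Rightarrow> nat) set"
  where "shuffle_perms p q =
    {\<sigma>. \<sigma> permutes {..<p + q} \<and> strict_mono_on {..<p} \<sigma> \<and> strict_mono_on {p..<p + q} \<sigma>}"

text \<open>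
  The part of \<open>[F, G]\<close> in which \<open>G\<close> is inserted into the first argument of \<open>F\<close>, for \<open>F\<close> of arity \<open>i\<close>
  and \<open>G\<close> of arity \<open>j\<close>. It is \<open>0\<close> when \<open>F\<close> has no argument (a sum over the empty set of
  \<open>(j, -1)\<close>-shuffles), and it is a map of arity \<open>i + j - 1\<close>.
\<close>

definition insertion ::
  "(complex \<Rightarrow> 'a::ab_group_add \<Rightarrow> 'a) \<Rightarrow> nat \<Rightarrow> nat \<Rightarrow> ('a list \<Rightarrow> 'a) \<Rightarrow> ('a list \<Rightarrow> 'a) \<Rightarrow> ('a list \<Rightarrow> 'a)"
  where "insertion scale i j F G xs =
    (if i = 0 \<or> length xs + 1 \<noteq> i + j then 0
     else (\<Sum>\<sigma>\<in>shuffle_perms j (i - 1). scale (of_int (sign \<sigma>))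
       (F (G (map (\<lambda>m. xs ! \<sigma> m) [0..<j]) # map (\<lambda>m. xs ! \<sigma> m) [j..<length xs]))))"

text \<open>
  For arities \<open>i = p + 1\<close> and \<open>j = q + 1\<close> the sign \<open>(-1)\<close> to the power \<open>p q\<close> is written with the
  exponent \<open>(i + 1) (j + 1)\<close>, which has the same parity and is a natural number also if \<open>i\<close> or
  \<open>j\<close> is \<open>0\<close>.
\<close>

definition bracket_deg ::
  "(complex \<Rightarrow> 'a::ab_group_add \<Rightarrow> 'a) \<Rightarrow> nat \<Rightarrow> nat \<Rightarrow> ('a list \<Rightarrow> 'a) \<Rightarrow> ('a list \<Rightarrow> 'a) \<Rightarrow> ('a list \<Rightarrow> 'a)"
  where "bracket_deg scale i j F G xs =
    scale ((-1) ^ ((i + 1) * (j + 1))) (insertion scale i j F G xs) - insertion scale j i G F xs"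

text \<open>
  The bilinear extension: \<open>bracket_deg scale i j F G\<close> evaluates \<open>F\<close> only on lists of length \<open>i\<close> and
  \<open>G\<close> only on lists of length \<open>j\<close>, so it depends only on the components of these arities. At a list of
  length \<open>n\<close> only the pairs with \<open>i + j = n + 1\<close> contribute.
\<close>

definition bracket ::
  "(complex \<Rightarrow> 'a::ab_group_add \<Rightarrow> 'a) \<Rightarrow> ('a list \<Rightarrow> 'a) \<Rightarrow> ('a list \<Rightarrow> 'a) \<Rightarrow> ('a list \<Rightarrow> 'a)"
  where "bracket scale F G xs =
    (\<Sum>(i, j) | i + j = length xs + 1. bracket_deg scale i j F G xs)"

definition fun_scale :: "(complex \<Rightarrow> 'b \<Rightarrow> 'b) \<Rightarrow> complex \<Rightarrow> ('x \<Rightarrow> 'b) \<Rightarrow> ('x \<Rightarrow> 'b)"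
  where "fun_scale s c f = (\<lambda>x. s c (f x))"

definition linear_iso_on ::
  "(complex \<Rightarrow> 'v::ab_group_add \<Rightarrow> 'v) \<Rightarrow> (complex \<Rightarrow> 'w::ab_group_add \<Rightarrow> 'w) \<Rightarrow> 'v set \<Rightarrow> 'w set \<Rightarrow> ('v \<Rightarrow> 'w) \<Rightarrow> bool"
  where "linear_iso_on s1 s2 V W f \<longleftrightarrow>
    module.subspace s1 V \<and> module.subspace s2 W \<and>
    (\<forall>x\<in>V. \<forall>y\<in>V. f (x + y) = f x + f y) \<and> (\<forall>c. \<forall>x\<in>V. f (s1 c x) = s2 c (f x)) \<and>
    bij_betw f V W"

end

theory Submission imports Defs begin

text \<open>
  Since \<open>B\<close> is non degenerate, \<open>C\<close> is determined by \<open>hat B C\<close>, and cyclicity together with skew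
  symmetry in the first \<open>k\<close> arguments is skew symmetry in all \<open>k + 1\<close> arguments, because the
  cyclic shift and the permutations fixing the last argument generate the symmetric group. Hence a
  cochain is cyclic iff its hat is a skew symmetric form. Stability under the bracket then only
  requires that the hat of \<open>[F, G]\<close> be skew symmetric: cyclicity moves the inserted argument to the
  last slot, so up to a sign both halves of the bracket are the parts of the shuffle sum of
  \<open>B (F (X\<^sub>1, \<dots>, X\<^sub>i), G (X\<^sub>i\<^sub>+\<^sub>1, \<dots>, X\<^sub>i\<^sub>+\<^sub>j))\<close> in which the last argument goes to
  \<open>G\<close>, respectively to \<open>F\<close>, and such a full shuffle sum is skew symmetric.
\<close>

subsection \<open>Permutations and shuffles\<close>

lemma permute_list_transpose:
  assumes "a < length xs" "b < length xs"
  shows "permute_list (Transposition.transpose a b) xs = xs[a := xs ! b, b := xs ! a]"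
  using assms
  by (intro nth_equalityI) (auto simp: permute_list_def nth_list_update Transposition.transpose_def)

lemma permute_list_snoc:
  assumes "\<sigma> permutes {..<length xs}"
  shows "permute_list \<sigma> (xs @ [y]) = permute_list \<sigma> xs @ [y]"
  using assms permutes_in_image[OF assms] permutes_not_in[OF assms, of "length xs"]
  by (auto simp: permute_list_def nth_append)

lemma sign_mult_permutes:
  fixes \<sigma> \<tau> :: "'a \<Rightarrow> 'a"
  assumes "finite A" "\<sigma> permutes A" "\<tau> permutes A"
  shows "sign (\<sigma> \<circ> \<tau>) = sign \<sigma> * sign \<tau>"
  using assms by (meson permutes_imp_permutation sign_compose)

text \<open>Transpositions generate the permutations of a finite set, so a change of sign under
  every swap inside \<open>A\<close> forces the signature. Since \<open>A\<close> may be any set of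
  positions, one block of arguments can be treated at a time.\<close>

lemma skew_of_transpositions:
  fixes f :: "'a list \<Rightarrow> complex"
  assumes A: "A \<subseteq> {..<N}" and \<sigma>: "\<sigma> permutes A"
    and swap: "\<And>a b xs. a \<in> A \<Longrightarrow> b \<in> A \<Longrightarrow> a \<noteq> b \<Longrightarrow> length xs = N \<Longrightarrow>
      f (xs[a := xs ! b, b := xs ! a]) = - f xs"
    and len: "length xs = N"
  shows "f (permute_list \<sigma> xs) = of_int (sign \<sigma>) * f xs"
proof -
  have fin: "finite A"
    using A finite_subset by blast
  from fin \<sigma> show ?thesis
  proof (induction rule: permutes_rev_induct)
    case (swap a b p)
    let ?t = "Transposition.transpose a b"
    have t: "?t permutes A"
      using swap.hyps by (simp add: permutes_swap_id)
    \<comment> \<open>Permuting lists is a right action: the right factor of a composition acts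
      last, here as a swap of two entries of \<open>permute_list p xs\<close>.\<close>
    have "f (permute_list (p \<circ> ?t) xs) = f (permute_list ?t (permute_list p xs))"
      using t A len permutes_subset by (subst permute_list_compose) auto
    also have "\<dots> = - f (permute_list p xs)"
      using swap.hyps A len by (subst permute_list_transpose) (auto intro!: assms(3))
    also have "\<dots> = of_int (- sign p) * f xs"
      by (simp add: swap.IH)
    also have "- sign p = sign (p \<circ> ?t)"
      unfolding sign_mult_permutes[OF fin swap.hyps(4) t] using swap.hyps by (simp add: sign_swap_id)
    finally show ?case .
  qed simp
qed

text \<open>The cycle sending each \<open>m < k\<close> to \<open>m + 1\<close> and \<open>k\<close>
  to \<open>0\<close>. Building it from \<open>k\<close> adjacent transpositions makes its signature
  immediate; on lists of length \<open>k + 1\<close> it acts as \<open>rotate1\<close>.\<close>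

primrec cyc :: "nat \<Rightarrow> nat \<Rightarrow> nat" where
  "cyc 0 = id"
| "cyc (Suc k) = cyc k \<circ> Transposition.transpose k (Suc k)"

lemma cyc_apply: "cyc k m = (if m < k then Suc m else if m = k then 0 else m)"
  by (induction k arbitrary: m) (auto simp: Transposition.transpose_def)

lemma cyc_permutes: "cyc k permutes {..<Suc k}"
proof (induction k)
  case (Suc k)
  have "cyc k permutes {..<Suc (Suc k)}"
    using Suc by (rule permutes_subset) auto
  moreover have "Transposition.transpose k (Suc k) permutes {..<Suc (Suc k)}"
    by (simp add: permutes_swap_id)
  ultimately show ?case
    by (simp only: cyc.simps permutes_compose)
qed (simp only: cyc.simps permutes_id)

lemma sign_cyc: "sign (cyc k) = (-1) ^ k"
proof (induction k)
  case (Suc k)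
  have "permutation (cyc k)"
    using cyc_permutes permutes_imp_permutation by blast
  then show ?case
    unfolding cyc.simps by (subst sign_compose) (simp_all add: permutation_swap_id sign_swap_id Suc)
qed (simp only: cyc.simps sign_id power_0)

lemma permute_list_cyc:
  assumes "length xs = Suc k"
  shows "permute_list (cyc k) xs = rotate1 xs"
proof (rule nth_equalityI)
  fix m assume "m < length (permute_list (cyc k) xs)"
  then have "m < Suc k"
    using assms by simp
  then show "permute_list (cyc k) xs ! m = rotate1 xs ! m"
    using assms cyc_permutes[of k]
    by (cases "m = k") (auto simp: permute_list_nth nth_rotate1 cyc_apply)
qed simp

lemma cyc_funpow_permutes: "(cyc k ^^ r) permutes {..<Suc k}"
proof (induction r)
  case (Suc r)
  then show ?case
    using permutes_compose[OF Suc cyc_permutes] by (simp only: funpow.simps)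
qed (simp add: permutes_id[unfolded id_def] id_def)

lemma sign_cyc_funpow: "sign (cyc k ^^ r) = (-1) ^ (k * r)"
proof (induction r)
  case (Suc r)
  have "sign (cyc k ^^ Suc r) = sign (cyc k) * sign (cyc k ^^ r)"
    unfolding funpow.simps
    by (rule sign_mult_permutes[OF _ cyc_permutes cyc_funpow_permutes]) simp
  then show ?case
    using Suc by (simp add: sign_cyc power_add del: funpow.simps)
qed (simp add: sign_id[unfolded id_def] id_def)

lemma permute_list_cyc_funpow:
  assumes "length xs = Suc k"
  shows "permute_list (cyc k ^^ r) xs = rotate r xs"
proof (induction r)
  case (Suc r)
  have "permute_list (cyc k ^^ Suc r) xs = permute_list (cyc k) (permute_list (cyc k ^^ r) xs)"
    using assms by (simp only: funpow_Suc_right) (subst permute_list_compose, auto simp: cyc_permutes)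
  then show ?case
    using Suc permute_list_cyc[of "rotate r xs" k] assms by (simp only: rotate_Suc length_rotate)
qed (simp add: id_def)

lemma cyc_funpow_apply: "m < Suc k \<Longrightarrow> (cyc k ^^ r) m = (m + r) mod Suc k"
proof (induction r)
  case (Suc r)
  have "(m + r) mod Suc k < Suc k"
    by simp
  with Suc show ?case
    by (auto simp: cyc_apply mod_Suc simp del: mod_less_divisor)
qed simp

section \<open>Shuffles and subsets of positions\<close>

lemma shuffle_permsD:
  assumes "\<sigma> \<in> shuffle_perms p q"
  shows "\<sigma> permutes {..<p + q}"
    and "map \<sigma> [0..<p] = sorted_list_of_set (\<sigma> ` {..<p})"
    and "map \<sigma> [p..<p + q] = sorted_list_of_set ({..<p + q} - \<sigma> ` {..<p})"
proof -
  have \<sigma>: "\<sigma> permutes {..<p + q}"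
    and m1: "strict_mono_on {..<p} \<sigma>" and m2: "strict_mono_on {p..<p + q} \<sigma>"
    using assms by (auto simp: shuffle_perms_def)
  show "\<sigma> permutes {..<p + q}" by fact
  have inj: "inj_on \<sigma> S" for S
    using \<sigma> by (rule permutes_inj_on)
  have "sorted_wrt (<) (map \<sigma> [0..<p])"
    using m1 by (auto simp: sorted_wrt_iff_nth_less strict_mono_on_def)
  then show "map \<sigma> [0..<p] = sorted_list_of_set (\<sigma> ` {..<p})"
    using sorted_list_of_set_unique[of "\<sigma> ` {..<p}" "map \<sigma> [0..<p]"] inj[of "{..<p}"]
    by (simp add: card_image lessThan_atLeast0)
  have im: "{..<p + q} - \<sigma> ` {..<p} = \<sigma> ` {p..<p + q}"
  proof -
    have "{..<p + q} - \<sigma> ` {..<p} = \<sigma> ` {..<p + q} - \<sigma> ` {..<p}"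
      by (simp only: permutes_image[OF \<sigma>])
    also have "\<dots> = \<sigma> ` ({..<p + q} - {..<p})"
      by (rule image_set_diff[OF inj, symmetric])
    also have "{..<p + q} - {..<p} = {p..<p + q}"
      by auto
    finally show ?thesis .
  qed
  have "sorted_wrt (<) (map \<sigma> [p..<p + q])"
    using m2 by (auto simp: sorted_wrt_iff_nth_less strict_mono_on_def)
  then show "map \<sigma> [p..<p + q] = sorted_list_of_set ({..<p + q} - \<sigma> ` {..<p})"
    unfolding im
    using sorted_list_of_set_unique[of "\<sigma> ` {p..<p + q}" "map \<sigma> [p..<p + q]"] inj[of "{p..<p+q}"]
    by (simp add: card_image)
qed

text \<open>A shuffle lists the image of the first block and its complement in increasing order, so
  this image determines it. Sums over shuffles thereby become sums over \<open>p\<close>-subsets, on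
  which permutations act by taking images.\<close>

lemma bij_betw_shuffle_perms:
  "bij_betw (\<lambda>\<sigma>. \<sigma> ` {..<p}) (shuffle_perms p q) {K. K \<subseteq> {..<p + q} \<and> card K = p}"
proof (rule bij_betwI')
  fix \<sigma> \<tau> assume \<sigma>: "\<sigma> \<in> shuffle_perms p q" and \<tau>: "\<tau> \<in> shuffle_perms p q"
  have "\<sigma> = \<tau>" if eq: "\<sigma> ` {..<p} = \<tau> ` {..<p}"
  proof
    fix m
    have "map \<sigma> [0..<p] = map \<tau> [0..<p]" "map \<sigma> [p..<p + q] = map \<tau> [p..<p + q]"
      using shuffle_permsD(2,3)[OF \<sigma>] shuffle_permsD(2,3)[OF \<tau>] eq by auto
    then have "\<sigma> m = \<tau> m" if "m < p + q"
      using that by (cases "m < p") auto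
    then show "\<sigma> m = \<tau> m"
      using shuffle_permsD(1)[OF \<sigma>] shuffle_permsD(1)[OF \<tau>]
      by (metis lessThan_iff permutes_not_in)
  qed
  then show "(\<sigma> ` {..<p} = \<tau> ` {..<p}) = (\<sigma> = \<tau>)"
    by auto
next
  fix \<sigma> assume "\<sigma> \<in> shuffle_perms p q"
  then have \<sigma>: "\<sigma> permutes {..<p + q}"
    by (rule shuffle_permsD)
  then show "\<sigma> ` {..<p} \<in> {K. K \<subseteq> {..<p + q} \<and> card K = p}"
    using permutes_image[OF \<sigma>] card_image[OF permutes_inj_on[OF \<sigma>], of "{..<p}"]
    by (auto simp: permutes_in_image)
next
  fix K assume "K \<in> {K. K \<subseteq> {..<p + q} \<and> card K = p}"
  then have K: "K \<subseteq> {..<p + q}" "card K = p" and finK: "finite K"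
    using finite_subset by auto
  define L1 where "L1 = sorted_list_of_set K"
  define L2 where "L2 = sorted_list_of_set ({..<p + q} - K)"
  \<comment> \<open>The shuffle belonging to \<open>K\<close>: first the elements of
    \<open>K\<close>, then those of its complement, both in increasing order.\<close>
  define \<sigma> where "\<sigma> m = (if m < p + q then (L1 @ L2) ! m else m)" for m
  have len: "length L1 = p" "length L2 = q"
    using K finK by (simp_all add: L1_def L2_def card_Diff_subset)
  have s: "sorted_wrt (<) L1" "sorted_wrt (<) L2"
    by (simp_all add: L1_def L2_def)
  have set: "set L1 = K" "set L2 = {..<p + q} - K"
    using finK by (simp_all add: L1_def L2_def)
  have "distinct (L1 @ L2)"
    unfolding distinct_append using set by (simp add: L1_def L2_def)
  then have "bij_betw ((!) (L1 @ L2)) {..<p + q} {..<p + q}"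
    by (rule bij_betw_nth) (use len set K in \<open>auto simp del: sorted_list_of_set.set_sorted_key_list_of_set\<close>)
  then have "bij_betw \<sigma> {..<p + q} {..<p + q}"
    by (rule bij_betw_cong[THEN iffD1, rotated]) (simp add: \<sigma>_def)
  then have \<sigma>: "\<sigma> permutes {..<p + q}"
    by (rule bij_imp_permutes) (simp add: \<sigma>_def)
  have "strict_mono_on {..<p} \<sigma>"
    using s(1) len by (auto simp: strict_mono_on_def \<sigma>_def nth_append sorted_wrt_iff_nth_less)
  moreover have "strict_mono_on {p..<p + q} \<sigma>"
    using s(2) len by (auto simp: strict_mono_on_def \<sigma>_def nth_append sorted_wrt_iff_nth_less)
  moreover have "\<sigma> ` {..<p} = K"
  proof -
    have "\<sigma> ` {..<p} = (!) L1 ` {..<p}"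
      using len by (intro image_cong) (auto simp: \<sigma>_def nth_append)
    also have "\<dots> = set L1"
      using len by (auto simp: set_conv_nth)
    finally show ?thesis
      using set by simp
  qed
  ultimately show "\<exists>\<sigma>\<in>shuffle_perms p q. K = \<sigma> ` {..<p}"
    using \<sigma> by (auto simp: shuffle_perms_def)
qed

subsection \<open>Shuffle sums of block-wise skew functions\<close>

definition block_skew :: "nat \<Rightarrow> nat \<Rightarrow> ('a list \<Rightarrow> complex) \<Rightarrow> bool" where
  "block_skew p q H \<longleftrightarrow>
    (\<forall>a b xs. a \<noteq> b \<longrightarrow> length xs = p + q \<longrightarrow> {a, b} \<subseteq> {..<p} \<or> {a, b} \<subseteq> {p..<p + q} \<longrightarrow>
      H (xs[a := xs ! b, b := xs ! a]) = - H xs)"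

text \<open>When \<open>H\<close> is the product of a skew \<open>p\<close>-form and a skew
  \<open>q\<close>-form, this is their exterior product. The value \<open>0\<close> at other lengths
  matches the encoding of forms.\<close>

definition shuffle_sum :: "nat \<Rightarrow> nat \<Rightarrow> ('a list \<Rightarrow> complex) \<Rightarrow> 'a list \<Rightarrow> complex" where
  "shuffle_sum p q H xs =
    (if length xs = p + q
     then \<Sum>\<sigma>\<in>shuffle_perms p q. of_int (sign \<sigma>) * H (permute_list \<sigma> xs) else 0)"

text \<open>Permutations with the same image of the first block differ on the right by one that
  preserves both blocks. The sign that \<open>H\<close> picks up from the latter is the quotient of
  the two signatures, so the signed term depends on the image only.\<close>

lemma block_skew_cong:
  assumes H: "block_skew p q H" and len: "length xs = p + q"
    and \<rho>: "\<rho> permutes {..<p + q}" and \<tau>: "\<tau> permutes {..<p + q}"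
    and im: "\<rho> ` {..<p} = \<tau> ` {..<p}"
  shows "of_int (sign \<rho>) * H (permute_list \<rho> xs) = of_int (sign \<tau>) * H (permute_list \<tau> xs)"
proof -
  \<comment> \<open>By construction \<open>\<rho> = \<tau> \<circ> \<beta>\<close>. As
    \<open>\<beta>\<close> maps each block to itself, it is the product of its restrictions
    \<open>\<beta>1\<close> and \<open>\<beta>2\<close> to the blocks, each extended by the
    identity.\<close>
  define \<beta> where "\<beta> = inv \<tau> \<circ> \<rho>"
  define \<beta>1 where "\<beta>1 m = (if m < p then \<beta> m else m)" for m
  define \<beta>2 where "\<beta>2 m = (if m < p then m else \<beta> m)" for m
  have \<beta>: "\<beta> permutes {..<p + q}"
    unfolding \<beta>_def by (intro permutes_compose permutes_inv \<rho> \<tau>)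
  have "\<beta> ` {..<p} = inv \<tau> ` \<tau> ` {..<p}"
    unfolding \<beta>_def image_comp[symmetric] im ..
  then have im\<beta>: "\<beta> ` {..<p} = {..<p}"
    using \<tau> by (metis image_inv_f_f permutes_inj)
  have iff: "\<beta> m < p \<longleftrightarrow> m < p" for m
    using im\<beta> permutes_inj[OF \<beta>] by (metis inj_image_mem_iff lessThan_iff)
  have bij1: "bij_betw \<beta> {..<p} {..<p}"
    using im\<beta> permutes_inj_on[OF \<beta>] by (simp add: bij_betw_def)
  then have "bij_betw \<beta>1 {..<p} {..<p}"
    by (rule bij_betw_cong[THEN iffD1, rotated]) (simp add: \<beta>1_def)
  then have \<beta>1: "\<beta>1 permutes {..<p}"
    by (rule bij_imp_permutes) (simp add: \<beta>1_def)
  have "\<beta> ` {p..<p + q} = {p..<p + q}"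
  proof -
    have "{p..<p + q} = {..<p + q} - {..<p}" by auto
    then show ?thesis
      using image_set_diff[OF permutes_inj[OF \<beta>], of "{..<p + q}" "{..<p}"]
      by (simp only: im\<beta> permutes_image[OF \<beta>])
  qed
  then have "bij_betw \<beta> {p..<p + q} {p..<p + q}"
    using permutes_inj_on[OF \<beta>] by (simp add: bij_betw_def)
  then have "bij_betw \<beta>2 {p..<p + q} {p..<p + q}"
    by (rule bij_betw_cong[THEN iffD1, rotated]) (simp add: \<beta>2_def)
  then have \<beta>2: "\<beta>2 permutes {p..<p + q}"
    by (rule bij_imp_permutes) (use permutes_not_in[OF \<beta>] in \<open>auto simp: \<beta>2_def\<close>)
  have \<beta>1': "\<beta>1 permutes {..<p + q}" and \<beta>2': "\<beta>2 permutes {..<p + q}"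
    by (rule permutes_subset[OF \<beta>1] permutes_subset[OF \<beta>2]; auto)+
  have "\<beta> = \<beta>1 \<circ> \<beta>2"
    using iff by (auto simp: fun_eq_iff \<beta>1_def \<beta>2_def)
  then have \<rho>_eq: "\<rho> = (\<tau> \<circ> \<beta>1) \<circ> \<beta>2"
    using \<tau> by (metis \<beta>_def comp_assoc comp_id permutes_inv_o(1) id_comp)
  have "H (permute_list \<rho> xs) = H (permute_list \<beta>2 (permute_list \<beta>1 (permute_list \<tau> xs)))"
    unfolding \<rho>_eq using \<beta>1' \<beta>2' len by (simp only: permute_list_compose length_permute_list)
  also have "\<dots> = of_int (sign \<beta>2) * H (permute_list \<beta>1 (permute_list \<tau> xs))"
    by (rule skew_of_transpositions[OF _ \<beta>2, of "p + q"]) (use H len in \<open>auto simp: block_skew_def\<close>)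
  also have "H (permute_list \<beta>1 (permute_list \<tau> xs)) = of_int (sign \<beta>1) * H (permute_list \<tau> xs)"
    by (rule skew_of_transpositions[OF _ \<beta>1, of "p + q"]) (use H len in \<open>auto simp: block_skew_def\<close>)
  finally have "of_int (sign \<rho>) * H (permute_list \<rho> xs) =
      of_int (sign \<rho> * sign \<beta>2 * sign \<beta>1) * H (permute_list \<tau> xs)"
    by simp
  also have "sign \<rho> * sign \<beta>2 * sign \<beta>1 = sign \<tau>"
  proof -
    have "sign \<rho> = sign \<tau> * sign \<beta>1 * sign \<beta>2"
      unfolding \<rho>_eq using sign_mult_permutes[OF _ permutes_compose[OF \<beta>1' \<tau>] \<beta>2']
        sign_mult_permutes[OF _ \<tau> \<beta>1'] by simp
    then show ?thesis
      by (cases \<beta>1 rule: sign_cases; cases \<beta>2 rule: sign_cases) auto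
  qed
  finally show ?thesis .
qed

lemma block_skew_image:
  assumes "block_skew p q H" "length xs = p + q"
  obtains \<psi> where "\<And>\<rho>. \<rho> permutes {..<p + q} \<Longrightarrow>
    of_int (sign \<rho>) * H (permute_list \<rho> xs) = \<psi> (\<rho> ` {..<p})"
proof
  let ?P = "\<lambda>K \<rho>. \<rho> permutes {..<p + q} \<and> \<rho> ` {..<p} = K"
  fix \<rho> :: "nat \<Rightarrow> nat" assume \<rho>: "\<rho> permutes {..<p + q}"
  \<comment> \<open>Any permutation with the prescribed image serves as representative, by
    \<open>block_skew_cong\<close>.\<close>
  let ?\<tau> = "SOME \<tau>. ?P (\<rho> ` {..<p}) \<tau>"
  have "?P (\<rho> ` {..<p}) ?\<tau>"
    by (rule someI[of _ \<rho>]) (simp add: \<rho>)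
  then show "of_int (sign \<rho>) * H (permute_list \<rho> xs) =
      (\<lambda>K. let \<tau> = SOME \<tau>. ?P K \<tau> in of_int (sign \<tau>) * H (permute_list \<tau> xs)) (\<rho> ` {..<p})"
    unfolding Let_def by (intro block_skew_cong[OF assms \<rho>]) auto
qed

text \<open>Permuting the arguments by \<open>\<tau>\<close> replaces \<open>\<sigma>\<close> by
  \<open>\<tau> \<circ> \<sigma>\<close>, which need not be a shuffle. In terms of subsets the sum
  is merely reindexed by the bijection that \<open>\<tau>\<close> induces on
  \<open>p\<close>-subsets, while \<open>sign \<tau>\<close> comes out of every term.\<close>

lemma skew_symmetric_shuffle_sum:
  assumes H: "block_skew p q H"
  shows "skew_symmetric (*) (p + q) (shuffle_sum p q H)"
  unfolding skew_symmetric_def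
proof (intro allI impI)
  fix \<tau> :: "nat \<Rightarrow> nat" and xs :: "'a list"
  assume \<tau>: "\<tau> permutes {..<p + q}" and len: "length xs = p + q"
  let ?T = "\<lambda>\<rho>. of_int (sign \<rho>) * H (permute_list \<rho> xs)"
  let ?Ks = "{K. K \<subseteq> {..<p + q} \<and> card K = p}"
  obtain \<psi> where \<psi>: "\<And>\<rho>. \<rho> permutes {..<p + q} \<Longrightarrow> ?T \<rho> = \<psi> (\<rho> ` {..<p})"
    using block_skew_image[OF H len] by blast
  have "shuffle_sum p q H (permute_list \<tau> xs) =
      (\<Sum>\<sigma>\<in>shuffle_perms p q. of_int (sign \<tau>) * \<psi> (\<tau> ` (\<sigma> ` {..<p})))"
    unfolding shuffle_sum_def using len
  proof (simp, intro sum.cong refl)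
    fix \<sigma> assume "\<sigma> \<in> shuffle_perms p q"
    then have \<sigma>: "\<sigma> permutes {..<p + q}"
      by (rule shuffle_permsD)
    have "permute_list \<sigma> (permute_list \<tau> xs) = permute_list (\<tau> \<circ> \<sigma>) xs"
      by (simp only: permute_list_compose \<sigma> len)
    moreover have "sign \<sigma> = sign \<tau> * sign (\<tau> \<circ> \<sigma>)"
      by (subst sign_mult_permutes[OF _ \<tau> \<sigma>]) simp_all
    ultimately have "of_int (sign \<sigma>) * H (permute_list \<sigma> (permute_list \<tau> xs)) =
        of_int (sign \<tau>) * ?T (\<tau> \<circ> \<sigma>)"
      by (simp only: of_int_mult mult.assoc)
    also have "?T (\<tau> \<circ> \<sigma>) = \<psi> (\<tau> ` (\<sigma> ` {..<p}))"
      unfolding \<psi>[OF permutes_compose[OF \<sigma> \<tau>]] image_comp ..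
    finally show "of_int (sign \<sigma>) * H (permute_list \<sigma> (permute_list \<tau> xs)) =
        of_int (sign \<tau>) * \<psi> (\<tau> ` \<sigma> ` {..<p})" .
  qed
  also have "\<dots> = (\<Sum>K\<in>?Ks. of_int (sign \<tau>) * \<psi> (\<tau> ` K))"
    by (rule sum.reindex_bij_betw[OF bij_betw_shuffle_perms])
  also have "\<dots> = (\<Sum>K\<in>?Ks. of_int (sign \<tau>) * \<psi> K)"
  proof (rule sum.reindex_bij_betw)
    show "bij_betw ((`) \<tau>) ?Ks ?Ks"
    proof (rule bij_betw_byWitness[where f' = "(`) (inv \<tau>)"])
      have *: "\<pi> ` K \<in> ?Ks" if "\<pi> permutes {..<p + q}" "K \<in> ?Ks" for \<pi> K
        using that image_mono[of K "{..<p + q}" \<pi>]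
        by (simp add: card_image permutes_inj_on permutes_image)
      show "(`) \<tau> ` ?Ks \<subseteq> ?Ks" "(`) (inv \<tau>) ` ?Ks \<subseteq> ?Ks"
        using *[OF \<tau>] *[OF permutes_inv[OF \<tau>]] by blast+
    qed (use \<tau> in \<open>auto simp: image_comp permutes_inv_o\<close>)
  qed
  also have "\<dots> = (\<Sum>\<sigma>\<in>shuffle_perms p q. of_int (sign \<tau>) * \<psi> (\<sigma> ` {..<p}))"
    by (rule sum.reindex_bij_betw[OF bij_betw_shuffle_perms, symmetric])
  also have "\<dots> = of_int (sign \<tau>) * shuffle_sum p q H xs"
    unfolding shuffle_sum_def using len
    by (simp add: sum_distrib_left \<psi> shuffle_permsD(1))
  finally show "shuffle_sum p q H (permute_list \<tau> xs) = of_int (sign \<tau>) * shuffle_sum p q H xs" .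
qed

text \<open>
  The two sums on the right collect the shuffles that put the last argument into the second,
  respectively the first block. In the latter case the blocks are exchanged by a rotation, so that
  the last argument stays in place and only \<open>(q, p - 1)\<close>-shuffles of the others remain.
\<close>

lemma shuffle_sum_split_last:
  assumes H: "block_skew p q H" and n: "p + q = Suc n" and len: "length xs = Suc n"
  shows "shuffle_sum p q H xs =
      (if q = 0 then 0
       else \<Sum>\<sigma>\<in>shuffle_perms p (q - 1). of_int (sign \<sigma>) * H (permute_list \<sigma> xs)) +
      (if p = 0 then 0
       else (-1) ^ (p * q) *
         (\<Sum>\<sigma>\<in>shuffle_perms q (p - 1). of_int (sign \<sigma>) * H (rotate q (permute_list \<sigma> xs))))"
    (is "_ = ?A + ?B")
proof -
  let ?T = "\<lambda>\<rho>. of_int (sign \<rho>) * H (permute_list \<rho> xs)"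
  define Ks where "Ks = {K. K \<subseteq> {..<p + q} \<and> card K = p}"
  obtain \<psi> where \<psi>: "\<And>\<rho>. \<rho> permutes {..<p + q} \<Longrightarrow> ?T \<rho> = \<psi> (\<rho> ` {..<p})"
    using block_skew_image[OF H, of xs] len n by auto
  have fin: "finite Ks"
    unfolding Ks_def by (rule finite_subset[of _ "Pow {..<p + q}"]) auto
  have "shuffle_sum p q H xs = (\<Sum>\<sigma>\<in>shuffle_perms p q. \<psi> (\<sigma> ` {..<p}))"
    using len n unfolding shuffle_sum_def by (auto intro!: sum.cong \<psi> dest: shuffle_permsD(1))
  also have "\<dots> = (\<Sum>K\<in>Ks. \<psi> K)"
    unfolding Ks_def by (rule sum.reindex_bij_betw[OF bij_betw_shuffle_perms])
  \<comment> \<open>\<open>K\<close> is the set of positions read by the first block, and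
    \<open>n\<close> is the position of the last argument.\<close>
  also have "\<dots> = (\<Sum>K\<in>{K\<in>Ks. n \<notin> K}. \<psi> K) + (\<Sum>K\<in>{K\<in>Ks. n \<in> K}. \<psi> K)"
    using fin by (subst sum.union_disjoint[symmetric]) (auto intro!: sum.cong)
  also have "(\<Sum>K\<in>{K\<in>Ks. n \<notin> K}. \<psi> K) = ?A"
  proof (cases "q = 0")
    case True
    have "{K\<in>Ks. n \<notin> K} = {}"
    proof -
      have False if "K \<subseteq> {..<Suc n}" "card K = Suc n" "n \<notin> K" for K
        using card_subset_eq[of "{..<Suc n}" K] that by auto
      then show ?thesis
        using True n by (auto simp: Ks_def)
    qed
    with True show ?thesis
      by (simp only: sum.empty if_True refl)
  next
    case False
    then have q: "p + (q - 1) = n"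
      using n by simp
    \<comment> \<open>A \<open>(p, q - 1)\<close>-shuffle of the first \<open>n\<close> positions is
      a permutation of all positions that fixes \<open>n\<close>; its images of the first block are
      the \<open>p\<close>-subsets avoiding \<open>n\<close>.\<close>
    have "(\<Sum>\<sigma>\<in>shuffle_perms p (q - 1). ?T \<sigma>) = (\<Sum>\<sigma>\<in>shuffle_perms p (q - 1). \<psi> (\<sigma> ` {..<p}))"
    proof (intro sum.cong refl \<psi>)
      fix \<sigma> assume "\<sigma> \<in> shuffle_perms p (q - 1)"
      from shuffle_permsD(1)[OF this] show "\<sigma> permutes {..<p + q}"
        by (rule permutes_subset) auto
    qed
    also have "\<dots> = (\<Sum>K\<in>{K. K \<subseteq> {..<n} \<and> card K = p}. \<psi> K)"
      using sum.reindex_bij_betw[OF bij_betw_shuffle_perms, of \<psi> p "q - 1"] q by simp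
    also have "{K. K \<subseteq> {..<n} \<and> card K = p} = {K\<in>Ks. n \<notin> K}"
      using n by (auto simp: Ks_def lessThan_Suc)
    finally show ?thesis
      using False by simp
  qed
  also have "(\<Sum>K\<in>{K\<in>Ks. n \<in> K}. \<psi> K) = ?B"
  proof (cases "p = 0")
    case True
    have "{K\<in>Ks. n \<in> K} = {}"
      using True finite_subset by (fastforce simp: Ks_def)
    with True show ?thesis
      by (simp only: sum.empty if_True refl)
  next
    case False
    then have p: "q + (p - 1) = n"
      using n by simp
    \<comment> \<open>\<open>?c\<close> rotates lists by \<open>q\<close>, moving a leading block of
      \<open>q\<close> arguments to the end. Hence under \<open>\<sigma> \<circ> ?c\<close> the
      first \<open>p\<close> slots read the positions that \<open>\<sigma>\<close> does not assign
      to its first \<open>q\<close> slots.\<close>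
    let ?c = "cyc n ^^ q" and ?L = "{K. K \<subseteq> {..<n} \<and> card K = q}"
    have c: "?c permutes {..<p + q}"
      unfolding n by (rule cyc_funpow_permutes)
    \<comment> \<open>Since \<open>n = p + q - 1\<close>, the exponents differ by
      \<open>q * (q - 1)\<close>, which is even.\<close>
    have parity: "(-1) ^ (n * q) = ((-1) ^ (p * q) :: int)"
    proof -
      have "even (n * q) \<longleftrightarrow> even (p * q)"
        using n by (metis even_Suc even_add even_mult_iff)
      then show ?thesis
        by (simp add: minus_one_power_iff)
    qed
    have c_im: "?c ` {..<p} = {..<p + q} - {..<q}"
    proof -
      have "?c m = m + q" if "m < p" for m
        using that n by (subst cyc_funpow_apply) auto
      then have "?c ` {..<p} = (\<lambda>m. m + q) ` {..<p}"
        by (intro image_cong) auto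
      also have "\<dots> = {..<p + q} - {..<q}"
        unfolding lessThan_atLeast0 image_add_atLeastLessThan' by auto
      finally show ?thesis .
    qed
    have "of_int (sign \<sigma>) * H (rotate q (permute_list \<sigma> xs)) =
        (-1) ^ (p * q) * \<psi> ({..<p + q} - \<sigma> ` {..<q})" if "\<sigma> \<in> shuffle_perms q (p - 1)" for \<sigma>
    proof -
      have "\<sigma> permutes {..<q + (p - 1)}"
        by (rule shuffle_permsD(1)) fact
      then have \<sigma>: "\<sigma> permutes {..<p + q}"
        by (rule permutes_subset) auto
      have "sign (\<sigma> \<circ> ?c) = sign \<sigma> * (-1) ^ (p * q)"
        by (subst sign_mult_permutes[OF _ \<sigma> c]) (simp_all only: sign_cyc_funpow parity finite_lessThan)
      moreover have "permute_list (\<sigma> \<circ> ?c) xs = rotate q (permute_list \<sigma> xs)"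
        using c n len by (subst permute_list_compose) (auto simp: permute_list_cyc_funpow)
      moreover have "(\<sigma> \<circ> ?c) ` {..<p} = {..<p + q} - \<sigma> ` {..<q}"
        unfolding image_comp[symmetric] c_im image_set_diff[OF permutes_inj[OF \<sigma>]] permutes_image[OF \<sigma>] ..
      ultimately have "of_int (sign \<sigma> * (-1) ^ (p * q)) * H (rotate q (permute_list \<sigma> xs)) =
          \<psi> ({..<p + q} - \<sigma> ` {..<q})"
        using \<psi>[OF permutes_compose[OF c \<sigma>]] by (simp only:)
      from this[symmetric] show ?thesis
        by (simp add: mult_ac)
    qed
    then have "?B = (-1) ^ (p * q) * ((-1) ^ (p * q) *
        (\<Sum>\<sigma>\<in>shuffle_perms q (p - 1). \<psi> ({..<p + q} - \<sigma> ` {..<q})))"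
      using False by (simp add: sum_distrib_left)
    also have "\<dots> = (\<Sum>\<sigma>\<in>shuffle_perms q (p - 1). \<psi> ({..<p + q} - \<sigma> ` {..<q}))"
      by (simp add: minus_one_power_iff)
    also have "\<dots> = (\<Sum>L\<in>?L. \<psi> ({..<p + q} - L))"
      using sum.reindex_bij_betw[OF bij_betw_shuffle_perms, of "\<lambda>L. \<psi> ({..<p + q} - L)" q "p - 1"] p
      by simp
    also have "\<dots> = (\<Sum>K\<in>{K\<in>Ks. n \<in> K}. \<psi> K)"
    proof (rule sum.reindex_bij_betw)
      \<comment> \<open>The complement of a \<open>q\<close>-subset avoiding \<open>n\<close> is a
        \<open>p\<close>-subset containing \<open>n\<close>, and conversely.\<close>
      show "bij_betw (\<lambda>L. {..<p + q} - L) ?L {K\<in>Ks. n \<in> K}"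
      proof (rule bij_betw_byWitness[where f' = "\<lambda>K. {..<p + q} - K"])
        show "(\<lambda>L. {..<p + q} - L) ` ?L \<subseteq> {K\<in>Ks. n \<in> K}"
        proof clarify
          fix L assume L: "L \<subseteq> {..<n}" "q = card L"
          then have "L \<subseteq> {..<p + q}" "n \<notin> L" "finite L"
            using n finite_subset by auto
          then show "{..<p + card L} - L \<in> Ks \<and> n \<in> {..<p + card L} - L"
            using L n by (auto simp: Ks_def card_Diff_subset)
        qed
        show "(\<lambda>K. {..<p + q} - K) ` {K\<in>Ks. n \<in> K} \<subseteq> ?L"
        proof clarify
          fix K assume K: "K \<in> Ks" "n \<in> K"
          then have "finite K" "K \<subseteq> {..<p + q}" "card K = p"
            using finite_subset by (auto simp: Ks_def)
          then have "card ({..<p + q} - K) = q"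
            by (simp add: card_Diff_subset)
          moreover have "{..<p + q} - K \<subseteq> {..<n}"
            using K n by (auto simp: less_Suc_eq)
          ultimately show "{..<p + q} - K \<subseteq> {..<n} \<and> card ({..<p + q} - K) = q"
            by blast
        qed
      qed (use n in \<open>auto simp: Ks_def\<close>)
    qed
    finally show ?thesis ..
  qed
  finally show ?thesis .
qed

text \<open>Any \<open>\<sigma>\<close> factors as \<open>c \<circ> \<rho>\<close>, where
  \<open>c\<close> is the power of the cycle that takes \<open>k\<close> to
  \<open>\<sigma> k\<close> and \<open>\<rho>\<close> fixes \<open>k\<close>. Each factor
  contributes its own signature.\<close>

lemma skew_symmetric_of_cyclic:
  fixes f :: "'a list \<Rightarrow> complex"
  assumes rot: "\<And>xs. length xs = Suc k \<Longrightarrow> f (rotate1 xs) = (-1) ^ k * f xs"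
    and fix_last: "\<And>\<sigma> xs. \<sigma> permutes {..<k} \<Longrightarrow> length xs = Suc k \<Longrightarrow>
      f (permute_list \<sigma> xs) = of_int (sign \<sigma>) * f xs"
  shows "skew_symmetric (*) (Suc k) f"
  unfolding skew_symmetric_def
proof (intro allI impI)
  fix \<sigma> :: "nat \<Rightarrow> nat" and xs :: "'a list"
  assume \<sigma>: "\<sigma> permutes {..<Suc k}" and len: "length xs = Suc k"
  \<comment> \<open>The exponent is \<open>\<sigma> k + 1\<close> because
    \<open>k + \<sigma> k + 1\<close> is congruent to \<open>\<sigma> k\<close> modulo
    \<open>k + 1\<close>.\<close>
  define c where "c = cyc k ^^ Suc (\<sigma> k)"
  define \<rho> where "\<rho> = inv c \<circ> \<sigma>"
  have c: "c permutes {..<Suc k}"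
    unfolding c_def by (rule cyc_funpow_permutes)
  have \<rho>': "\<rho> permutes {..<Suc k}"
    unfolding \<rho>_def by (intro permutes_compose permutes_inv \<sigma> c)
  have "\<sigma> k < Suc k"
    using permutes_in_image[OF \<sigma>, of k] by simp
  then have "c k = \<sigma> k"
    unfolding c_def using mod_add_self1[of "Suc k" "\<sigma> k"]
    by (subst cyc_funpow_apply) (simp_all only: lessI add_Suc_shift mod_less)
  then have "\<rho> k = k"
    unfolding \<rho>_def using permutes_inverses(2)[OF c, of k] by simp
  then have \<rho>: "\<rho> permutes {..<k}"
    by (intro permutes_superset[OF \<rho>']) (auto simp: less_Suc_eq)
  have \<sigma>_eq: "\<sigma> = c \<circ> \<rho>"
    unfolding \<rho>_def comp_assoc[symmetric] permutes_inv_o(1)[OF c] by simp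
  have rots: "f (rotate r xs) = (-1) ^ (k * r) * f xs" for r
    by (induction r) (simp_all add: rot len power_add)
  have "f (permute_list \<sigma> xs) = f (permute_list \<rho> (permute_list c xs))"
    unfolding \<sigma>_eq by (subst permute_list_compose) (simp_all add: \<rho>' len)
  also have "\<dots> = of_int (sign \<rho>) * f (permute_list c xs)"
    by (rule fix_last) (simp_all add: \<rho> len)
  also have "f (permute_list c xs) = (-1) ^ (k * Suc (\<sigma> k)) * f xs"
    unfolding c_def by (simp only: permute_list_cyc_funpow len rots)
  also have "(-1) ^ (k * Suc (\<sigma> k)) = complex_of_int (sign c)"
    unfolding c_def by (simp only: sign_cyc_funpow of_int_power of_int_minus of_int_1)
  also have "of_int (sign \<rho>) * (of_int (sign c) * f xs) = of_int (sign \<sigma>) * f xs"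
    unfolding \<sigma>_eq by (subst sign_mult_permutes[OF _ c \<rho>']) simp_all
  finally show "f (permute_list \<sigma> xs) = of_int (sign \<sigma>) * f xs" .
qed

subsection \<open>Cyclic cochains and skew forms\<close>

definition component :: "nat \<Rightarrow> ('a list \<Rightarrow> 'b::zero) \<Rightarrow> 'a list \<Rightarrow> 'b" where
  "component k f xs = (if length xs = k then f xs else 0)"

lemma sum_fun_apply: "sum F K x = (\<Sum>k\<in>K. F k x)" for F :: "'k \<Rightarrow> 'x \<Rightarrow> 'b::comm_monoid_add"
  by (induction K rule: infinite_finite_induct) simp_all

text \<open>Summands of different degrees live on lists of different lengths, so the component of
  degree \<open>k\<close> is the summand of that degree, or \<open>0\<close> if there is none. What
  remains of the finite sum is the finiteness of the set of lengths where \<open>f\<close> is non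
  zero.\<close>

lemma graded_sum_iff_component:
  fixes V :: "nat \<Rightarrow> ('a list \<Rightarrow> 'b::comm_monoid_add) set"
  assumes homogeneous: "\<And>k f xs. f \<in> V k \<Longrightarrow> length xs \<noteq> k \<Longrightarrow> f xs = 0"
    and zero: "\<And>k. 0 \<in> V k"
  shows "f \<in> graded_sum I V \<longleftrightarrow>
    (\<forall>k\<in>I. component k f \<in> V k) \<and>
    (\<exists>K. finite K \<and> K \<subseteq> I \<and> (\<forall>xs. length xs \<notin> K \<longrightarrow> f xs = 0))"
    (is "?L \<longleftrightarrow> ?R")
proof
  assume ?L
  then obtain K F where K: "finite K" "K \<subseteq> I" and F: "\<And>k. k \<in> K \<Longrightarrow> F k \<in> V k"
    and f: "f = (\<Sum>k\<in>K. F k)"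
    by (auto simp: graded_sum_def)
  have fx: "f xs = (if length xs \<in> K then F (length xs) xs else 0)" for xs
  proof -
    have "f xs = (\<Sum>k\<in>K. if k = length xs then F k xs else 0)"
      unfolding f sum_fun_apply using homogeneous F by (intro sum.cong refl) fastforce
    then show ?thesis
      using K by (simp add: sum.delta')
  qed
  have "component k f \<in> V k" for k
  proof -
    have "component k f = (if k \<in> K then F k else 0)"
    proof
      fix xs show "component k f xs = (if k \<in> K then F k else 0) xs"
        using homogeneous[OF F[of k], of xs] by (cases "length xs = k") (auto simp: component_def fx)
    qed
    then show ?thesis
      using F zero by simp
  qed
  then show ?R
    using K fx by auto
next
  assume ?R
  then obtain K where K: "finite K" "K \<subseteq> I" "\<forall>xs. length xs \<notin> K \<longrightarrow> f xs = 0"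
    and comp: "\<forall>k\<in>I. component k f \<in> V k"
    by blast
  have "f = (\<Sum>k\<in>K. component k f)"
  proof
    fix xs show "f xs = (\<Sum>k\<in>K. component k f) xs"
      using K by (simp add: sum_fun_apply component_def sum.delta')
  qed
  moreover have "\<forall>k\<in>K. component k f \<in> V k"
    using K comp by auto
  ultimately show ?L
    unfolding graded_sum_def
    by (intro CollectI exI[of _ K] exI[of _ "\<lambda>k. component k f"] conjI K)
qed

context quadratic_vector_space
begin

section \<open>The bilinear form and the hat of a map\<close>

lemma vector_space_complex: "vector_space ((*) :: complex \<Rightarrow> complex \<Rightarrow> complex)"
  by unfold_locales (simp_all add: algebra_simps)

lemma linear_form_iff:
  "Vector_Spaces.linear scale (*) f \<longleftrightarrow>
    (\<forall>x y. f (x + y) = f x + f y) \<and> (\<forall>c x. f (scale c x) = c * (f x :: complex))"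
  by (simp add: Vector_Spaces.linear_iff vector_space_axioms vector_space_complex)

lemma linear_map_iff:
  "Vector_Spaces.linear scale scale f \<longleftrightarrow>
    (\<forall>x y. f (x + y) = f x + f y) \<and> (\<forall>c x. f (scale c x) = scale c (f x))"
  by (simp add: Vector_Spaces.linear_iff vector_space_axioms)

lemma B_simps [simp]:
  "B (x + y) z = B x z + B y z" "B z (x + y) = B z x + B z y"
  "B (scale c x) z = c * B x z" "B z (scale c x) = c * B z x"
  using linear_left linear_right by (simp_all add: linear_form_iff)

lemma B_zero [simp]: "B 0 x = 0" "B x 0 = 0"
  using B_simps(3)[of 0 0 x] B_simps(4)[of x 0 0] by simp_all

lemma B_minus [simp]: "B (- x) y = - B x y" "B (x - y) z = B x z - B y z"
proof -
  have minus: "B (- x) y = - B x y" for x y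
    using B_simps(1)[of x "- x" y] by (simp add: add_eq_0_iff)
  show "B (- x) y = - B x y" by (rule minus)
  show "B (x - y) z = B x z - B y z"
    using B_simps(1)[of x "- y" z] minus by simp
qed

lemma B_sum: "B (sum f A) y = (\<Sum>a\<in>A. B (f a) y)"
  by (induction A rule: infinite_finite_induct) simp_all

lemma B_eqI: "(\<And>y. B u y = B v y) \<Longrightarrow> u = v"
  using nondegenerate[of "u - v"] by simp

lemma hat_snoc [simp]: "hat B C (xs @ [y]) = B (C xs) y"
  by (simp add: hat_def)

lemma hat_Nil [simp]: "hat B C [] = 0"
  by (simp add: hat_def)

text \<open>Evaluating the hat at \<open>xs @ [y]\<close> for all \<open>y\<close> tests
  \<open>C xs\<close> against the whole space, so non degeneracy recovers \<open>C\<close>.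
  Injectivity on cyclic cochains is a special case.\<close>

lemma hat_eq_iff: "hat B C = hat B D \<longleftrightarrow> C = D"
proof
  assume eq: "hat B C = hat B D"
  show "C = D"
  proof
    fix xs show "C xs = D xs"
      using fun_cong[OF eq, of "xs @ [y]" for y] by (intro B_eqI) simp
  qed
qed simp

lemma hat_add: "hat B (C + D) = hat B C + hat B D"
  by (simp add: hat_def fun_eq_iff)

lemma hat_fun_scale: "hat B (fun_scale scale c C) = fun_scale (*) c (hat B C)"
  by (simp add: hat_def fun_scale_def fun_eq_iff)

lemma hat_zero [simp]: "hat B 0 = 0"
  by (simp add: hat_def fun_eq_iff)

lemma hat_component: "hat B (component k C) = component (Suc k) (hat B C)"
proof
  fix xs show "hat B (component k C) xs = component (Suc k) (hat B C) xs"
    by (cases xs rule: rev_cases) (simp_all add: component_def)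
qed

text \<open>The cyclic condition written with \<open>rotate1\<close>, to match the action of
  \<open>cyc\<close>. Inserting \<open>rotate1 zs\<close> for the list in the original condition
  gives this one.\<close>

definition cyclic_form :: "nat \<Rightarrow> ('a list \<Rightarrow> complex) \<Rightarrow> bool" where
  "cyclic_form k f \<longleftrightarrow> (\<forall>zs. length zs = Suc k \<longrightarrow> f (rotate1 zs) = (-1) ^ k * f zs)"

lemma cyclic_form_iff:
  "cyclic_form k f \<longleftrightarrow> (\<forall>ys. length ys = k + 1 \<longrightarrow> f ys = (-1) ^ k * f (last ys # butlast ys))"
proof
  assume f: "cyclic_form k f"
  show "\<forall>ys. length ys = k + 1 \<longrightarrow> f ys = (-1) ^ k * f (last ys # butlast ys)"
  proof (intro allI impI)
    fix ys :: "'a list" assume len: "length ys = k + 1"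
    then have "ys = rotate1 (last ys # butlast ys)" "length (last ys # butlast ys) = Suc k"
      by (simp_all add: append_butlast_last_id[of ys] flip: length_greater_0_conv)
    then show "f ys = (-1) ^ k * f (last ys # butlast ys)"
      using f unfolding cyclic_form_def by metis
  qed
next
  assume f: "\<forall>ys. length ys = k + 1 \<longrightarrow> f ys = (-1) ^ k * f (last ys # butlast ys)"
  show "cyclic_form k f"
    unfolding cyclic_form_def
  proof (intro allI impI)
    fix zs :: "'a list" assume "length zs = Suc k"
    then obtain z zs' where "zs = z # zs'"
      by (cases zs) auto
    then show "f (rotate1 zs) = (-1) ^ k * f zs"
      using f[rule_format, of "rotate1 zs"] \<open>length zs = Suc k\<close> by simp
  qed
qed

lemma cyclic_cochains_deg_iff:
  "C \<in> cyclic_cochains_deg scale B k \<longleftrightarrow>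
    multilinear scale scale k C \<and> skew_symmetric scale k C \<and> cyclic_form k (hat B C) \<and>
    (\<forall>xs. length xs \<noteq> k \<longrightarrow> C xs = 0)"
  unfolding cyclic_cochains_deg_def cochains_deg_def skew_maps_def cyclic_form_iff by blast

lemma multilinear_hat:
  assumes C: "multilinear scale scale k C"
  shows "multilinear scale (*) (Suc k) (hat B C)"
  unfolding multilinear_def
proof (intro allI impI)
  fix zs :: "'a list" and i assume "length zs = Suc k" and i: "i < Suc k"
  then obtain xs y where zs: "zs = xs @ [y]" and len: "length xs = k"
    by (cases zs rule: rev_cases) auto
  show "Vector_Spaces.linear scale (*) (\<lambda>x. hat B C (zs[i := x]))"
  proof (cases "i = k")
    case True
    then show ?thesis
      using len by (auto simp: zs linear_form_iff list_update_length)
  next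
    case False
    with i have "i < k" by simp
    then show ?thesis
      using C len unfolding multilinear_def zs
      by (simp add: linear_form_iff linear_map_iff list_update_append)
  qed
qed

lemma skew_symmetric_hat:
  assumes C: "skew_symmetric scale k C" and cyclic: "cyclic_form k (hat B C)"
  shows "skew_symmetric (*) (Suc k) (hat B C)"
proof (rule skew_symmetric_of_cyclic)
  fix \<sigma> :: "nat \<Rightarrow> nat" and zs :: "'a list"
  assume \<sigma>: "\<sigma> permutes {..<k}" and "length zs = Suc k"
  then obtain xs y where zs: "zs = xs @ [y]" and len: "length xs = k"
    by (cases zs rule: rev_cases) auto
  then show "hat B C (permute_list \<sigma> zs) = of_int (sign \<sigma>) * hat B C zs"
    using C \<sigma> by (simp add: permute_list_snoc skew_symmetric_def)
qed (use cyclic in \<open>simp add: cyclic_form_def\<close>)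

text \<open>A skew form returns all properties of \<open>C\<close>: multilinearity and skew symmetry
  are tested against an arbitrary last argument through \<open>B_eqI\<close>, and cyclicity is skew
  symmetry for \<open>cyc k\<close>. As only the support of \<open>C\<close> is prescribed, a map
  obtained merely from its hat can be recognised as a cyclic cochain.\<close>

lemma cyclic_cochains_deg_iff_hat:
  assumes zero: "\<And>xs. length xs \<noteq> k \<Longrightarrow> C xs = 0"
  shows "C \<in> cyclic_cochains_deg scale B k \<longleftrightarrow> hat B C \<in> forms_deg scale (Suc k)"
proof
  assume "C \<in> cyclic_cochains_deg scale B k"
  moreover have "hat B C xs = 0" if "length xs \<noteq> Suc k" for xs
    using that zero by (cases xs rule: rev_cases) auto
  ultimately show "hat B C \<in> forms_deg scale (Suc k)"
    unfolding forms_deg_def skew_maps_def cyclic_cochains_deg_iff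
    using multilinear_hat skew_symmetric_hat by blast
next
  assume "hat B C \<in> forms_deg scale (Suc k)"
  then have ml: "multilinear scale (*) (Suc k) (hat B C)"
    and sk: "skew_symmetric (*) (Suc k) (hat B C)"
    by (auto simp: forms_deg_def skew_maps_def)
  have "multilinear scale scale k C"
    unfolding multilinear_def
  proof (intro allI impI)
    fix xs :: "'a list" and i assume len: "length xs = k" and i: "i < k"
    have "Vector_Spaces.linear scale (*) (\<lambda>x. B (C (xs[i := x])) y)" for y
      using ml[unfolded multilinear_def, rule_format, of "xs @ [y]" i] len i
      by (simp add: list_update_append)
    then show "Vector_Spaces.linear scale scale (\<lambda>x. C (xs[i := x]))"
      unfolding linear_map_iff by (auto intro!: B_eqI simp: linear_form_iff)
  qed
  moreover have "skew_symmetric scale k C"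
    unfolding skew_symmetric_def
  proof (intro allI impI B_eqI)
    fix \<sigma> :: "nat \<Rightarrow> nat" and xs :: "'a list" and y
    assume \<sigma>: "\<sigma> permutes {..<k}" and len: "length xs = k"
    have "\<sigma> permutes {..<Suc k}"
      using \<sigma> by (rule permutes_subset) auto
    then have "hat B C (permute_list \<sigma> (xs @ [y])) = of_int (sign \<sigma>) * hat B C (xs @ [y])"
      using sk len by (simp add: skew_symmetric_def)
    then show "B (C (permute_list \<sigma> xs)) y = B (scale (of_int (sign \<sigma>)) (C xs)) y"
      using \<sigma> len by (simp add: permute_list_snoc)
  qed
  moreover have "cyclic_form k (hat B C)"
    unfolding cyclic_form_def
  proof (intro allI impI)
    fix zs :: "'a list" assume "length zs = Suc k"
    then show "hat B C (rotate1 zs) = (- 1) ^ k * hat B C zs"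
      using sk[unfolded skew_symmetric_def, rule_format, OF cyc_permutes, of zs]
      by (simp add: permute_list_cyc sign_cyc)
  qed
  ultimately show "C \<in> cyclic_cochains_deg scale B k"
    unfolding cyclic_cochains_deg_iff using zero by blast
qed

section \<open>The graded spaces of forms and of cyclic cochains\<close>

lemma forms_deg_zero: "0 \<in> forms_deg scale k"
  by (auto simp: forms_deg_def skew_maps_def multilinear_def skew_symmetric_def linear_form_iff)

lemma forms_deg_add:
  assumes "f \<in> forms_deg scale k" "g \<in> forms_deg scale k"
  shows "f + g \<in> forms_deg scale k"
  using assms
  by (auto simp: forms_deg_def skew_maps_def multilinear_def skew_symmetric_def linear_form_iff
      algebra_simps)

lemma forms_deg_scale:
  assumes "f \<in> forms_deg scale k"
  shows "fun_scale (*) c f \<in> forms_deg scale k"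
  using assms
  by (auto simp: forms_deg_def skew_maps_def multilinear_def skew_symmetric_def linear_form_iff
      fun_scale_def algebra_simps)

lemma forms_deg_sum:
  "(\<And>a. a \<in> A \<Longrightarrow> f a \<in> forms_deg scale k) \<Longrightarrow> sum f A \<in> forms_deg scale k"
  by (induction A rule: infinite_finite_induct) (simp_all add: forms_deg_zero forms_deg_add)

lemma forms_plus_iff:
  "f \<in> forms_plus scale \<longleftrightarrow>
    (\<forall>k\<ge>1. component k f \<in> forms_deg scale k) \<and>
    (\<exists>K. finite K \<and> K \<subseteq> {1..} \<and> (\<forall>xs. length xs \<notin> K \<longrightarrow> f xs = 0))"
  unfolding forms_plus_def
  by (subst graded_sum_iff_component[OF _ forms_deg_zero]) (auto simp: forms_deg_def skew_maps_def)

lemma cyclic_cochains_deg_zero: "0 \<in> cyclic_cochains_deg scale B k"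
  by (subst cyclic_cochains_deg_iff_hat) (simp_all add: forms_deg_zero)

lemma cyclic_cochains_iff:
  "C \<in> cyclic_cochains scale B \<longleftrightarrow>
    (\<forall>k. component k C \<in> cyclic_cochains_deg scale B k) \<and>
    (\<exists>K. finite K \<and> (\<forall>xs. length xs \<notin> K \<longrightarrow> C xs = 0))"
  unfolding cyclic_cochains_def
  by (subst graded_sum_iff_component[OF _ cyclic_cochains_deg_zero])
    (auto simp: cyclic_cochains_deg_iff)

text \<open>The homogeneous case applied to all components, with the arity raised by one. Only
  positive degrees arise, since the hat vanishes at \<open>[]\<close>. As \<open>C\<close> is an
  arbitrary function on lists, later questions about cyclic cochains can be settled on the side of
  forms.\<close>

lemma cyclic_cochains_iff_hat:
  "C \<in> cyclic_cochains scale B \<longleftrightarrow> hat B C \<in> forms_plus scale"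
proof -
  have "(\<forall>k. component k C \<in> cyclic_cochains_deg scale B k) \<longleftrightarrow>
      (\<forall>k. component (Suc k) (hat B C) \<in> forms_deg scale (Suc k))"
    unfolding hat_component[symmetric]
    by (intro all_cong1 cyclic_cochains_deg_iff_hat) (simp add: component_def)
  also have "\<dots> \<longleftrightarrow> (\<forall>k\<ge>1. component k (hat B C) \<in> forms_deg scale k)"
    by (metis One_nat_def Suc_le_D Suc_le_mono le0)
  finally have 1: "(\<forall>k. component k C \<in> cyclic_cochains_deg scale B k) \<longleftrightarrow>
      (\<forall>k\<ge>1. component k (hat B C) \<in> forms_deg scale k)" .
  have 2: "(\<exists>K. finite K \<and> (\<forall>xs. length xs \<notin> K \<longrightarrow> C xs = 0)) \<longleftrightarrow>
      (\<exists>K. finite K \<and> K \<subseteq> {1..} \<and> (\<forall>zs. length zs \<notin> K \<longrightarrow> hat B C zs = 0))"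
    (is "?L \<longleftrightarrow> ?R")
  proof
    assume ?L
    then obtain K where K: "finite K" "\<And>xs. length xs \<notin> K \<Longrightarrow> C xs = 0"
      by blast
    have "hat B C zs = 0" if "length zs \<notin> Suc ` K" for zs
      using that K(2)[of "butlast zs"] by (cases zs rule: rev_cases) (auto simp: image_iff)
    then show ?R
      using K(1) by (intro exI[of _ "Suc ` K"]) auto
  next
    assume ?R
    then obtain K where K: "finite K" "\<And>zs. length zs \<notin> K \<Longrightarrow> hat B C zs = 0"
      by blast
    \<comment> \<open>Non degeneracy transfers vanishing from the hat back to \<open>C\<close>, one
      degree lower.\<close>
    have "C xs = 0" if "length xs \<notin> Suc -` K" for xs
      using that K(2)[of "xs @ [y]" for y] by (intro nondegenerate) simp
    then show ?L
      using finite_vimageI[OF K(1), of Suc] by (intro exI[of _ "Suc -` K"]) auto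
  qed
  show ?thesis
    unfolding cyclic_cochains_iff forms_plus_iff 1 2 ..
qed

text \<open>All components of a homogeneous cochain other than itself are \<open>0\<close>, so the
  criterion for sums specialises to a single degree.\<close>

lemma cochain_cyclic_iff:
  assumes C: "C \<in> cochains_deg scale k"
  shows "C \<in> cyclic_cochains_deg scale B k \<longleftrightarrow> hat B C \<in> forms_plus scale"
proof -
  have zero: "length xs \<noteq> k \<Longrightarrow> C xs = 0" for xs
    using C by (simp add: cochains_deg_def skew_maps_def)
  then have comp: "component j C = (if j = k then C else 0)" for j
    by (auto simp: component_def fun_eq_iff)
  have "C \<in> cyclic_cochains scale B \<longleftrightarrow> C \<in> cyclic_cochains_deg scale B k"
    unfolding cyclic_cochains_iff comp
    using zero by (auto simp: cyclic_cochains_deg_zero intro!: exI[of _ "{k}"])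
  then show ?thesis
    by (simp add: cyclic_cochains_iff_hat)
qed

lemma subspace_forms_plus: "module.subspace (fun_scale (*)) (forms_plus scale)"
proof -
  have module: "module (fun_scale ((*) :: complex \<Rightarrow> _) :: _ \<Rightarrow> ('a list \<Rightarrow> complex) \<Rightarrow> _)"
    by unfold_locales (simp_all add: fun_scale_def fun_eq_iff algebra_simps)
  have 0: "0 \<in> forms_plus scale"
    unfolding forms_plus_iff
  proof (intro conjI allI impI)
    fix k have "component k 0 = (0 :: 'a list \<Rightarrow> complex)"
      by (auto simp: component_def)
    then show "component k 0 \<in> forms_deg scale k"
      by (simp only: forms_deg_zero)
  qed (auto intro!: exI[of _ "{}"])
  have add: "f + g \<in> forms_plus scale"
    if f: "f \<in> forms_plus scale" and g: "g \<in> forms_plus scale" for f g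
    unfolding forms_plus_iff
  proof (intro conjI allI impI)
    fix k :: nat assume "1 \<le> k"
    moreover have "component k (f + g) = component k f + component k g"
      by (auto simp: component_def fun_eq_iff)
    ultimately show "component k (f + g) \<in> forms_deg scale k"
      using f g forms_deg_add by (simp add: forms_plus_iff)
  next
    obtain K L where "finite K" "K \<subseteq> {1..}" "\<forall>xs. length xs \<notin> K \<longrightarrow> f xs = 0"
      and "finite L" "L \<subseteq> {1..}" "\<forall>xs. length xs \<notin> L \<longrightarrow> g xs = 0"
      using f g unfolding forms_plus_iff by blast
    then show "\<exists>K. finite K \<and> K \<subseteq> {1..} \<and> (\<forall>xs. length xs \<notin> K \<longrightarrow> (f + g) xs = 0)"
      by (intro exI[of _ "K \<union> L"]) auto
  qed
  have scale: "fun_scale (*) c f \<in> forms_plus scale" if f: "f \<in> forms_plus scale" for c f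
    unfolding forms_plus_iff
  proof (intro conjI allI impI)
    fix k :: nat assume "1 \<le> k"
    moreover have "component k (fun_scale (*) c f) = fun_scale (*) c (component k f)"
      by (auto simp: component_def fun_scale_def fun_eq_iff)
    ultimately show "component k (fun_scale (*) c f) \<in> forms_deg scale k"
      using f forms_deg_scale by (simp add: forms_plus_iff)
  next
    show "\<exists>K. finite K \<and> K \<subseteq> {1..} \<and> (\<forall>xs. length xs \<notin> K \<longrightarrow> fun_scale (*) c f xs = 0)"
      using f unfolding forms_plus_iff by (auto simp: fun_scale_def)
  qed
  show ?thesis
    unfolding module.subspace_def[OF module] using 0 add scale by blast
qed

text \<open>The cyclic cochains are the preimage of the subspace of forms under the linear map
  \<open>hat B\<close>.\<close>

lemma subspace_cyclic_cochains: "module.subspace (fun_scale scale) (cyclic_cochains scale B)"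
proof -
  have module: "module (fun_scale scale :: _ \<Rightarrow> ('a list \<Rightarrow> 'a) \<Rightarrow> _)"
    by unfold_locales (simp_all add: fun_scale_def fun_eq_iff algebra_simps)
  have module': "module (fun_scale ((*) :: complex \<Rightarrow> _) :: _ \<Rightarrow> ('a list \<Rightarrow> complex) \<Rightarrow> _)"
    by unfold_locales (simp_all add: fun_scale_def fun_eq_iff algebra_simps)
  show ?thesis
    unfolding module.subspace_def[OF module] cyclic_cochains_iff_hat hat_add hat_fun_scale
    using subspace_forms_plus[unfolded module.subspace_def[OF module']]
    by (auto simp: cyclic_cochains_iff_hat hat_add hat_fun_scale)
qed

section \<open>Finite dimension: representing linear forms by vectors\<close>

lemma riesz_representation:
  assumes "finite_dimensional_vector_space scale Basis"
    and l: "Vector_Spaces.linear scale (*) l"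
  shows "\<exists>z. \<forall>y. B z y = l y"
proof -
  interpret fd: finite_dimensional_vector_space scale Basis by fact
  \<comment> \<open>The functional \<open>B z\<close> is encoded by the vector whose coordinates are
    its values on the basis. This makes \<open>\<phi>\<close> an endomorphism: non degeneracy gives
    injectivity, and finite dimension turns it into surjectivity.\<close>
  define \<phi> where "\<phi> z = (\<Sum>b\<in>Basis. scale (B z b) b)" for z
  have rep: "B z b = c b" if "\<phi> z = (\<Sum>b\<in>Basis. scale (c b) b)" "b \<in> Basis" for z b c
  proof -
    have "(\<Sum>b\<in>Basis. scale (B z b - c b) b) = 0"
      using that(1) by (simp add: \<phi>_def algebra_simps sum_subtractf)
    then show ?thesis
      using independentD[OF fd.independent_Basis fd.finite_Basis subset_refl _ that(2),
          of "\<lambda>b. B z b - c b"] by simp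
  qed
  have extend: "f y = g y"
    if "Vector_Spaces.linear scale (*) f" "Vector_Spaces.linear scale (*) g"
      "\<And>b. b \<in> Basis \<Longrightarrow> f b = g b" for f g y
  proof -
    interpret vector_space_pair scale "(*) :: complex \<Rightarrow> complex \<Rightarrow> complex"
      by (intro vector_space_pair.intro vector_space_axioms vector_space_complex)
    show ?thesis
      using linear_eq_on[OF that(1,2), of y Basis] that(3) fd.span_Basis by auto
  qed
  have "Vector_Spaces.linear scale scale \<phi>"
    by (simp add: linear_map_iff \<phi>_def algebra_simps sum.distrib scale_sum_right)
  moreover have "inj \<phi>"
  proof (rule injI)
    fix u v assume "\<phi> u = \<phi> v"
    then have "B u b = B v b" if "b \<in> Basis" for b
      using rep[of u "B v"] that by (simp add: \<phi>_def)
    then have "B u y = B v y" for y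
      by (rule extend[of "B u" "B v", OF linear_right linear_right])
    then show "u = v"
      by (rule B_eqI)
  qed
  ultimately have "surj \<phi>"
    by (rule fd.linear_inj_imp_surj)
  \<comment> \<open>A preimage of the vector that encodes \<open>l\<close> in the same way; it
    represents \<open>l\<close> on the basis, hence everywhere.\<close>
  then obtain z where "\<phi> z = (\<Sum>b\<in>Basis. scale (l b) b)"
    by (auto dest!: surjD[of _ "\<Sum>b\<in>Basis. scale (l b) b"])
  then have "B z b = l b" if "b \<in> Basis" for b
    using that by (rule rep)
  then have "B z y = l y" for y
    by (rule extend[of "B z" l, OF linear_right l])
  then show ?thesis
    by blast
qed

text \<open>For fixed \<open>xs\<close> the form is linear in its last argument, and
  \<open>C xs\<close> is chosen as the vector representing this functional. Then
  \<open>hat B C = f\<close>, and by \<open>cyclic_cochains_iff_hat\<close> this alone makes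
  \<open>C\<close> a cyclic cochain.\<close>

lemma forms_plus_subset_image_hat:
  assumes "finite_dimensional_vector_space scale Basis"
  shows "forms_plus scale \<subseteq> hat B ` cyclic_cochains scale B"
proof
  fix f assume f: "f \<in> forms_plus scale"
  have "\<exists>z. \<forall>y. B z y = f (xs @ [y])" for xs
  proof (rule riesz_representation[OF assms])
    have "component (Suc (length xs)) f \<in> forms_deg scale (Suc (length xs))"
      using f by (simp add: forms_plus_iff)
    then have "multilinear scale (*) (Suc (length xs)) (component (Suc (length xs)) f)"
      by (simp add: forms_deg_def skew_maps_def)
    \<comment> \<open>The entry \<open>0\<close> is a placeholder that the update at position
      \<open>length xs\<close> overwrites.\<close>
    from this[unfolded multilinear_def, rule_format, of "xs @ [0]" "length xs"]
    show "Vector_Spaces.linear scale (*) (\<lambda>y. f (xs @ [y]))"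
      by (simp add: component_def)
  qed
  then obtain C where C: "\<And>xs y. B (C xs) y = f (xs @ [y])"
    by metis
  have "hat B C zs = f zs" for zs
  proof (cases zs rule: rev_cases)
    \<comment> \<open>Both sides are \<open>0\<close> at \<open>[]\<close>, because
      \<open>forms_plus\<close> has no part of degree \<open>0\<close>.\<close>
    case Nil
    then show ?thesis
      using f unfolding forms_plus_iff by fastforce
  qed (simp add: C)
  then have "hat B C = f" ..
  then show "f \<in> hat B ` cyclic_cochains scale B"
    using f by (auto simp: cyclic_cochains_iff_hat)
qed

subsection \<open>The bracket\<close>

definition pairing :: "nat \<Rightarrow> ('a list \<Rightarrow> 'a) \<Rightarrow> ('a list \<Rightarrow> 'a) \<Rightarrow> 'a list \<Rightarrow> complex" where
  "pairing i F G xs = B (F (take i xs)) (G (drop i xs))"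

lemma skew_symmetric_swap:
  assumes F: "skew_symmetric scale k F" and "length xs = k" "a < k" "b < k" "a \<noteq> b"
  shows "F (xs[a := xs ! b, b := xs ! a]) = - F xs"
proof -
  have "Transposition.transpose a b permutes {..<k}"
    using assms by (simp add: permutes_swap_id)
  then have "F (permute_list (Transposition.transpose a b) xs) =
      scale (of_int (sign (Transposition.transpose a b))) (F xs)"
    using F assms by (simp add: skew_symmetric_def)
  then show ?thesis
    using assms by (simp add: permute_list_transpose sign_swap_id)
qed

lemma block_skew_pairing:
  assumes F: "skew_symmetric scale i F" and G: "skew_symmetric scale j G"
  shows "block_skew i j (pairing i F G)"
  unfolding block_skew_def
proof (intro allI impI)
  fix a b and xs :: "'a list"
  assume ab: "a \<noteq> b" and len: "length xs = i + j"
    and "{a, b} \<subseteq> {..<i} \<or> {a, b} \<subseteq> {i..<i + j}"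
  then consider "a < i" "b < i" | "i \<le> a" "i \<le> b" "a < i + j" "b < i + j"
    by auto
  then show "pairing i F G (xs[a := xs ! b, b := xs ! a]) = - pairing i F G xs"
  proof cases
    case 1
    then show ?thesis
      using skew_symmetric_swap[OF F, of "take i xs" a b] ab len
      by (simp add: pairing_def take_update_swap)
  next
    case 2
    then have "G ((drop i xs)[a - i := xs ! b, b - i := xs ! a]) = - G (drop i xs)"
      using skew_symmetric_swap[OF G, of "drop i xs" "a - i" "b - i"] ab len
      by simp
    with 2 show ?thesis
      by (simp add: pairing_def drop_update_swap symmetric[of "F _"])
  qed
qed

lemma multilinear_pairing:
  assumes F: "multilinear scale scale i F" and G: "multilinear scale scale j G"
  shows "multilinear scale (*) (i + j) (pairing i F G)"
  unfolding multilinear_def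
proof (intro allI impI)
  fix xs :: "'a list" and m assume len: "length xs = i + j" and m: "m < i + j"
  show "Vector_Spaces.linear scale (*) (\<lambda>x. pairing i F G (xs[m := x]))"
  proof (cases "m < i")
    case True
    then show ?thesis
      using F[unfolded multilinear_def, rule_format, of "take i xs" m] len
      by (simp add: pairing_def take_update_swap linear_form_iff linear_map_iff)
  next
    case False
    then show ?thesis
      using G[unfolded multilinear_def, rule_format, of "drop i xs" "m - i"] len m
      by (simp add: pairing_def drop_update_swap linear_form_iff linear_map_iff)
  qed
qed

lemma multilinear_shuffle_sum:
  assumes H: "multilinear scale (*) (p + q) H"
  shows "multilinear scale (*) (p + q) (shuffle_sum p q H)"
  unfolding multilinear_def
proof (intro allI impI)
  fix xs :: "'a list" and m assume len: "length xs = p + q" and m: "m < p + q"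
  define h where "h \<sigma> x = H ((permute_list \<sigma> xs)[inv \<sigma> m := x])" for \<sigma> x
  \<comment> \<open>Replacing entry \<open>m\<close> before permuting amounts to replacing entry
    \<open>inv \<sigma> m\<close> afterwards, so each summand varies in a single slot of
    \<open>H\<close>.\<close>
  have update: "permute_list \<sigma> (xs[m := x]) = (permute_list \<sigma> xs)[inv \<sigma> m := x]"
    if "\<sigma> \<in> shuffle_perms p q" for \<sigma> x
  proof (rule nth_equalityI)
    note \<sigma> = shuffle_permsD(1)[OF that]
    fix l assume "l < length (permute_list \<sigma> (xs[m := x]))"
    moreover have "inv \<sigma> m = l \<longleftrightarrow> m = \<sigma> l"
      by (metis permutes_inv_eq[OF \<sigma>])
    ultimately show "permute_list \<sigma> (xs[m := x]) ! l = (permute_list \<sigma> xs)[inv \<sigma> m := x] ! l"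
      using \<sigma> len m by (auto simp: permute_list_nth nth_list_update)
  qed simp
  have eq: "shuffle_sum p q H (xs[m := x]) =
      (\<Sum>\<sigma>\<in>shuffle_perms p q. of_int (sign \<sigma>) * h \<sigma> x)" for x
    using len by (simp add: shuffle_sum_def update h_def)
  have "Vector_Spaces.linear scale (*) (h \<sigma>)" if "\<sigma> \<in> shuffle_perms p q" for \<sigma>
  proof -
    have "inv \<sigma> m < p + q"
      using permutes_in_image[OF permutes_inv[OF shuffle_permsD(1)[OF that]], of m] m by simp
    then show ?thesis
      using H len unfolding multilinear_def h_def by simp
  qed
  then show "Vector_Spaces.linear scale (*) (\<lambda>x. shuffle_sum p q H (xs[m := x]))"
    unfolding eq linear_form_iff
    by (auto simp: algebra_simps sum_distrib_left simp flip: sum.distrib intro!: sum.cong)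
qed

text \<open>Cyclicity of \<open>G\<close> carries the inserted value of \<open>F\<close> from the
  first slot of \<open>G\<close> to the slot outside, while \<open>y\<close> becomes the last
  argument of \<open>G\<close>; symmetry of \<open>B\<close> then gives the pairing. The shuffles
  fix the last position, so \<open>y\<close> stays in place.\<close>

lemma B_insertion:
  assumes G: "cyclic_form j (hat B G)" and j: "0 < j" and len: "length xs + 1 = i + j"
  shows "B (insertion scale j i G F xs) y =
    (-1) ^ j * (\<Sum>\<sigma>\<in>shuffle_perms i (j - 1).
      of_int (sign \<sigma>) * pairing i F G (permute_list \<sigma> (xs @ [y])))"
proof -
  have "B (G (F (map (\<lambda>m. xs ! \<sigma> m) [0..<i]) # map (\<lambda>m. xs ! \<sigma> m) [i..<length xs])) y =
      (-1) ^ j * pairing i F G (permute_list \<sigma> (xs @ [y]))" if "\<sigma> \<in> shuffle_perms i (j - 1)" for \<sigma>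
  proof -
    have "i + (j - 1) = length xs"
      using len j by simp
    then have \<sigma>: "\<sigma> permutes {..<length xs}" and i: "i \<le> length xs"
      using shuffle_permsD(1)[OF that] by simp_all
    let ?a = "F (take i (permute_list \<sigma> xs))" and ?b = "drop i (permute_list \<sigma> xs)"
    have ab: "map (\<lambda>m. xs ! \<sigma> m) [0..<i] = take i (permute_list \<sigma> xs)"
      "map (\<lambda>m. xs ! \<sigma> m) [i..<length xs] = ?b"
      using i by (simp_all add: permute_list_def take_map drop_map)
    have "hat B G (rotate1 (?a # ?b @ [y])) = (-1) ^ j * hat B G (?a # ?b @ [y])"
      using G[unfolded cyclic_form_def, rule_format, of "?a # ?b @ [y]"] len i by fastforce
    moreover have "hat B G (?a # ?b @ [y]) = B (G (?a # ?b)) y"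
      using hat_snoc[of G "?a # ?b" y] by simp
    moreover have "hat B G (rotate1 (?a # ?b @ [y])) = B (G (?b @ [y])) ?a"
      using hat_snoc[of G "?b @ [y]" ?a] by simp
    ultimately have "B (G (?b @ [y])) ?a = (-1) ^ j * B (G (?a # ?b)) y"
      by simp
    then have "B (G (?a # ?b)) y = (-1) ^ j * B ?a (G (?b @ [y]))"
      by (simp add: symmetric[of ?a] minus_one_power_iff)
    then show ?thesis
      unfolding ab permute_list_snoc[OF \<sigma>] pairing_def using i by simp
  qed
  then show ?thesis
    using j len by (simp add: insertion_def B_sum sum_distrib_left mult_ac)
qed

text \<open>The insertion of \<open>F\<close> into \<open>G\<close> and that of \<open>G\<close>
  into \<open>F\<close> yield the two parts of \<open>shuffle_sum_split_last\<close>, with the last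
  argument in \<open>G\<close> and in \<open>F\<close> respectively. At the empty list, where
  \<open>i = j = 0\<close>, the shuffle sum would be \<open>B (F []) (G [])\<close>, whereas the hat
  is \<open>0\<close>.\<close>

lemma hat_bracket_deg:
  assumes F: "skew_symmetric scale i F" "cyclic_form i (hat B F)"
    and G: "skew_symmetric scale j G" "cyclic_form j (hat B G)"
    and zs: "length zs = i + j" "zs \<noteq> []"
  shows "hat B (bracket_deg scale i j F G) zs =
    (-1) ^ (j + 1) * shuffle_sum i j (pairing i F G) zs"
proof -
  obtain xs y where xs: "zs = xs @ [y]"
    using zs(2) by (cases zs rule: rev_cases) auto
  then have len: "length xs + 1 = i + j" and len': "length xs + 1 = j + i"
    using zs by simp_all
  let ?P = "\<Sum>\<sigma>\<in>shuffle_perms i (j - 1). of_int (sign \<sigma>) * pairing i F G (permute_list \<sigma> zs)"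
  let ?Q = "\<Sum>\<sigma>\<in>shuffle_perms j (i - 1). of_int (sign \<sigma>) * pairing j G F (permute_list \<sigma> zs)"
  \<comment> \<open>The rotation exchanges the two blocks, and symmetry of \<open>B\<close>
    exchanges the two factors.\<close>
  have rotate: "pairing i F G (rotate j (permute_list \<sigma> zs)) = pairing j G F (permute_list \<sigma> zs)" for \<sigma>
  proof -
    have "rotate j (permute_list \<sigma> zs) = drop j (permute_list \<sigma> zs) @ take j (permute_list \<sigma> zs)"
      using rotate_append[of "take j (permute_list \<sigma> zs)" "drop j (permute_list \<sigma> zs)"] zs by simp
    then show ?thesis
      using zs symmetric by (simp add: pairing_def)
  qed
  have shuffle: "shuffle_sum i j (pairing i F G) zs =
      (if j = 0 then 0 else ?P) + (if i = 0 then 0 else (-1) ^ (i * j) * ?Q)"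
    by (rule shuffle_sum_split_last[OF block_skew_pairing[OF F(1) G(1)], of "length xs" zs,
          unfolded rotate]) (use len xs in simp_all)
  have P: "B (insertion scale j i G F xs) y = (if j = 0 then 0 else (-1) ^ j * ?P)"
    using B_insertion[OF G(2) _ len, of F y] xs by (simp add: insertion_def)
  have Q: "B (insertion scale i j F G xs) y = (if i = 0 then 0 else (-1) ^ i * ?Q)"
    using B_insertion[OF F(2) _ len', of G y] xs by (simp add: insertion_def)
  \<comment> \<open>The sign in the definition of the bracket is what lets both halves share the
    factor \<open>(-1) ^ (j + 1)\<close>: the exponents \<open>(i + 1) * (j + 1) + i\<close> and
    \<open>(j + 1) + i * j\<close> differ by \<open>2 * i\<close>.\<close>
  have "(-1) ^ ((i + 1) * (j + 1)) * (-1) ^ i = (-1) ^ (j + 1) * ((-1) ^ (i * j) :: complex)"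
    by (auto simp: minus_one_power_iff)
  then have sgn: "(-1) ^ ((i + 1) * (j + 1)) * ((-1) ^ i * c) = (-1) ^ (j + 1) * ((-1) ^ (i * j) * c)"
    for c :: complex
    by (metis mult.assoc)
  have "hat B (bracket_deg scale i j F G) zs =
      (-1) ^ ((i + 1) * (j + 1)) * (if i = 0 then 0 else (-1) ^ i * ?Q) -
      (if j = 0 then 0 else (-1) ^ j * ?P)"
    unfolding xs hat_snoc bracket_deg_def B_minus B_simps P[unfolded xs] Q[unfolded xs] ..
  also have "\<dots> = (-1) ^ (j + 1) * shuffle_sum i j (pairing i F G) zs"
    unfolding shuffle distrib_left using sgn[of ?Q]
    by (cases "i = 0"; cases "j = 0") (simp_all add: add_ac)
  finally show ?thesis .
qed

text \<open>These predicates only look at lists of length \<open>k\<close>, or \<open>Suc k\<close>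
  for the hat, so an inhomogeneous \<open>F\<close> can stand in for its component of arity
  \<open>k\<close>.\<close>

lemma cyclic_cochains_component:
  assumes "F \<in> cyclic_cochains scale B"
  shows "multilinear scale scale k F" "skew_symmetric scale k F" "cyclic_form k (hat B F)"
proof -
  have "component k F \<in> cyclic_cochains_deg scale B k"
    using assms by (simp add: cyclic_cochains_iff)
  then have "multilinear scale scale k (component k F)" "skew_symmetric scale k (component k F)"
    "cyclic_form k (component (Suc k) (hat B F))"
    by (auto simp: cyclic_cochains_deg_iff hat_component)
  then show "multilinear scale scale k F" "skew_symmetric scale k F" "cyclic_form k (hat B F)"
    by (auto simp: multilinear_def skew_symmetric_def cyclic_form_def component_def)
qed

lemma shuffle_sum_pairing_form:
  assumes "F \<in> cyclic_cochains scale B" "G \<in> cyclic_cochains scale B"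
  shows "shuffle_sum i j (pairing i F G) \<in> forms_deg scale (i + j)"
  unfolding forms_deg_def skew_maps_def
  using multilinear_shuffle_sum[OF multilinear_pairing] skew_symmetric_shuffle_sum[OF block_skew_pairing]
    cyclic_cochains_component[OF assms(1)] cyclic_cochains_component[OF assms(2)]
  by (auto simp: shuffle_sum_def)

lemma hat_bracket:
  assumes F: "F \<in> cyclic_cochains scale B" and G: "G \<in> cyclic_cochains scale B"
    and zs: "length zs = n" "0 < n"
  shows "hat B (bracket scale F G) zs =
    (\<Sum>(i, j) | i + j = n. (-1) ^ (j + 1) * shuffle_sum i j (pairing i F G) zs)"
proof -
  obtain xs y where xs: "zs = xs @ [y]"
    using zs by (cases zs rule: rev_cases) auto
  \<comment> \<open>Here \<open>length xs + 1 = n\<close>, so the pairs summed in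
    \<open>bracket\<close> at \<open>xs\<close> are those with \<open>i + j = n\<close>.\<close>
  have "hat B (bracket scale F G) zs =
      (\<Sum>(i, j) | i + j = n. hat B (bracket_deg scale i j F G) zs)"
    using zs by (simp add: xs bracket_def B_sum case_prod_unfold)
  also have "\<dots> = (\<Sum>(i, j) | i + j = n. (-1) ^ (j + 1) * shuffle_sum i j (pairing i F G) zs)"
    using zs hat_bracket_deg[OF cyclic_cochains_component(2,3)[OF F] cyclic_cochains_component(2,3)[OF G]]
    by (intro sum.cong refl) (auto simp del: power_Suc)
  finally show ?thesis .
qed

text \<open>It suffices to study the hat: in each positive degree it is a signed finite sum of
  shuffle sums of pairings, which are skew forms, and only finitely many degrees occur.\<close>

lemma bracket_cyclic:
  assumes F: "F \<in> cyclic_cochains scale B" and G: "G \<in> cyclic_cochains scale B"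
  shows "bracket scale F G \<in> cyclic_cochains scale B"
  unfolding cyclic_cochains_iff_hat forms_plus_iff
proof (intro conjI allI impI)
  fix n :: nat assume n: "1 \<le> n"
  have "component n (hat B (bracket scale F G)) =
      (\<Sum>(i, j) | i + j = n. fun_scale (*) ((-1) ^ (j + 1)) (shuffle_sum i j (pairing i F G)))"
  proof
    fix zs :: "'a list"
    show "component n (hat B (bracket scale F G)) zs =
        (\<Sum>(i, j) | i + j = n.
          fun_scale (*) ((-1) ^ (j + 1)) (shuffle_sum i j (pairing i F G))) zs"
    proof (cases "length zs = n")
      case True
      then show ?thesis
        using n hat_bracket[OF F G True]
        by (simp add: component_def sum_fun_apply fun_scale_def case_prod_unfold)
    next
      case False
      then show ?thesis
        by (auto simp: component_def sum_fun_apply fun_scale_def shuffle_sum_def intro!: sum.neutral)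
    qed
  qed
  also have "\<dots> \<in> forms_deg scale n"
    using forms_deg_scale[OF shuffle_sum_pairing_form[OF F G]] by (intro forms_deg_sum) auto
  finally show "component n (hat B (bracket scale F G)) \<in> forms_deg scale n" .
next
  obtain K L where K: "finite K" "\<And>xs. length xs \<notin> K \<Longrightarrow> F xs = 0"
    and L: "finite L" "\<And>xs. length xs \<notin> L \<Longrightarrow> G xs = 0"
    using F G unfolding cyclic_cochains_iff by metis
  \<comment> \<open>Sums of an arity of \<open>F\<close> and an arity of \<open>G\<close>. Length
    \<open>0\<close>, which would come from two vectors, is removed because the hat vanishes
    there.\<close>
  let ?M = "(\<lambda>(i, j). i + j) ` (K \<times> L) \<inter> {1..}"
  have "hat B (bracket scale F G) zs = 0" if "length zs \<notin> ?M" for zs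
  proof (cases "zs = []")
    case False
    have "shuffle_sum i j (pairing i F G) zs = 0" if ij: "i + j = length zs" for i j
    proof (cases "i \<in> K \<and> j \<in> L")
      case True
      then have "length zs \<in> ?M"
        using False ij by (force simp: Suc_le_eq)
      then show ?thesis
        using \<open>length zs \<notin> ?M\<close> by simp
    next
      case False
      then have "pairing i F G xs = 0" if "length xs = i + j" for xs
        using K(2)[of "take i xs"] L(2)[of "drop i xs"] that by (auto simp: pairing_def)
      then show ?thesis
        by (simp add: shuffle_sum_def)
    qed
    then show ?thesis
      using False by (subst hat_bracket[OF F G refl]) (auto intro!: sum.neutral)
  qed simp
  then show "\<exists>K. finite K \<and> K \<subseteq> {1..} \<and> (\<forall>zs. length zs \<notin> K \<longrightarrow> hat B (bracket scale F G) zs = 0)"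
    using K(1) L(1) by (intro exI[of _ ?M]) auto
qed

lemma cyclic_cochains_subset_cochains: "cyclic_cochains scale B \<subseteq> cochains scale"
  unfolding cyclic_cochains_def cochains_def graded_sum_def cyclic_cochains_deg_def by blast

end

theorem proposition7p2p2:
  fixes scale :: "complex \<Rightarrow> 'a::ab_group_add \<Rightarrow> 'a"
    and B :: "'a \<Rightarrow> 'a \<Rightarrow> complex"
  assumes "quadratic_vector_space scale B"
  shows
    "(\<forall>k. \<forall>C\<in>cochains_deg scale k.
        C \<in> cyclic_cochains_deg scale B k \<longleftrightarrow> hat B C \<in> forms_plus scale) \<and>
     hat B ` cyclic_cochains scale B \<subseteq> forms_plus scale \<and>
     inj_on (hat B) (cyclic_cochains scale B) \<and>
     ((\<exists>Basis. finite_dimensional_vector_space scale Basis) \<longrightarrow>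
        linear_iso_on (fun_scale scale) (fun_scale (*))
          (cyclic_cochains scale B) (forms_plus scale) (hat B)) \<and>
     cyclic_cochains scale B \<subseteq> cochains scale \<and>
     module.subspace (fun_scale scale) (cyclic_cochains scale B) \<and>
     (\<forall>F\<in>cyclic_cochains scale B. \<forall>G\<in>cyclic_cochains scale B.
        bracket scale F G \<in> cyclic_cochains scale B)"
proof -
  interpret quadratic_vector_space scale B by fact
  have image: "hat B ` cyclic_cochains scale B \<subseteq> forms_plus scale"
    by (auto simp: cyclic_cochains_iff_hat)
  have inj: "inj_on (hat B) (cyclic_cochains scale B)"
    by (simp add: inj_on_def hat_eq_iff)
  have iso: "linear_iso_on (fun_scale scale) (fun_scale (*))
      (cyclic_cochains scale B) (forms_plus scale) (hat B)"
    if "finite_dimensional_vector_space scale Basis" for Basis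
    unfolding linear_iso_on_def bij_betw_def
    using subspace_cyclic_cochains subspace_forms_plus hat_add hat_fun_scale inj
      image forms_plus_subset_image_hat[OF that] by blast
  show ?thesis
    using cochain_cyclic_iff image inj iso cyclic_cochains_subset_cochains
      subspace_cyclic_cochains bracket_cyclic by blast
qed

end
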